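(* Let $G$ be a finite group with $|G|\ge 3$. 1. $1\in\Delta^*(G)$ and $\{\operatorname{ord}(g)-2 : g\in G \text{ with } \operatorname{ord}(g)\ge 3\}\subset\Delta^*(G)$. 2. $\max\Delta^*(G)\le \mathsf D(G)-2$. 3. $\max\Delta^*(G)=|G|-2$ if and only if $G$ is cyclic or a dihedral group of order $2n$ for some odd $n\ge 3$. 4. If $G$ is a dihedral group of order $2n$ for some odd $n\ge 3$, then $\{1,2,n-2,2n-2\}\subset\Delta^*(G)$ and $\max\bigl(\Delta^*(G)\setminus\{2n-2\}\bigr)=\max\{2,n-2\}$. 5. If $\max\Delta^*(G)=\mathsf D(G)-2$, then $G$ is cyclic or there is a subgroup $G_1\subset G$ such that $\mathsf D(G_1)=\mathsf D(G)$ and $G_1$ is generated by elements of order two.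
   Context: Let $G$ be a finite group, written multiplicatively, with identity $1_G$, and $G_0\subset G$ a subset. A sequence over $G_0$ is an element of the free abelian monoid $\mathcal F(G_0)$ with basis $G_0$ (a finite unordered list, repetition allowed), the operation being concatenation; $|S|$ is the number of terms of $S$ counted with multiplicity. A sequence is product-one if its terms can be ordered so that their product in $G$ equals $1_G$ (the empty sequence is product-one). $\mathcal B(G_0)$ is the monoid of product-one sequences over $G_0$. An atom is a nonempty product-one sequence that is not the concatenation of two nonempty product-one sequences; $\mathcal A(G_0)$ is the set of atoms of $\mathcal B(G_0)$. $\mathsf D(G_0)=\max\{|S|: S\in\mathcal A(G_0)\}$. For $A\in\mathcal B(G_0)$, $\mathsf L(A)$ is the set of all $k\in\mathbb N_0$ such that $A$ is a concatenation of $k$ atoms. For $L\subset\mathbb Z$, $\Delta(L)$ is the set of all $d\in\mathbb N$ for which there is $a\in L$ with $L\cap\{a,a+1,\dots,a+d\}=\{a,a+d\}$. Put $\Delta(G_0)=\bigcup_{A\in\mathcal B(G_0)}\Delta(\mathsf L(A))$ and $$\Delta^*(G)=\{\min\Delta(G_0): G_0\subset G\ \text{such that}\ \Delta(G_0)\ne\emptyset\}.$$ *)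

theory Defs
  imports "HOL-Algebra.Algebra" "HOL-Library.Multiset"
begin

text \<open>Sequences over a subset of a group are finite multisets; concatenation is multiset sum.\<close>

definition product_one :: "('a, 'b) monoid_scheme \<Rightarrow> 'a multiset \<Rightarrow> bool" where
  "product_one G S \<longleftrightarrow>
     (\<exists>xs. mset xs = S \<and> foldr (\<otimes>\<^bsub>G\<^esub>) xs \<one>\<^bsub>G\<^esub> = \<one>\<^bsub>G\<^esub>)"

definition product_one_seqs :: "('a, 'b) monoid_scheme \<Rightarrow> 'a set \<Rightarrow> 'a multiset set" where
  "product_one_seqs G G0 = {S. set_mset S \<subseteq> G0 \<and> product_one G S}"

definition atoms :: "('a, 'b) monoid_scheme \<Rightarrow> 'a set \<Rightarrow> 'a multiset set" where
  "atoms G G0 =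
     {A \<in> product_one_seqs G G0. A \<noteq> {#} \<and>
        \<not> (\<exists>B \<in> product_one_seqs G G0. \<exists>C \<in> product_one_seqs G G0.
              B \<noteq> {#} \<and> C \<noteq> {#} \<and> A = B + C)}"

text \<open>For a finite group there are only finitely many atoms, so the maximum below exists as soon
  as \<^term>\<open>G0\<close> is nonempty. For a subgroup \<open>G1\<close> of \<open>G\<close>, \<open>davenport G G1\<close> is the large Davenport
  constant of the group \<open>G1\<close>, since the operation of \<open>G1\<close> is that of \<open>G\<close>.\<close>

definition davenport :: "('a, 'b) monoid_scheme \<Rightarrow> 'a set \<Rightarrow> nat" where
  "davenport G G0 = Max (size ` atoms G G0)"

definition lengths :: "('a, 'b) monoid_scheme \<Rightarrow> 'a set \<Rightarrow> 'a multiset \<Rightarrow> nat set" where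
  "lengths G G0 A = {k. \<exists>F. set_mset F \<subseteq> atoms G G0 \<and> size F = k \<and> \<Sum>\<^sub># F = A}"

definition distances :: "nat set \<Rightarrow> nat set" where
  "distances L = {d. d \<ge> 1 \<and> (\<exists>a \<in> L. L \<inter> {a..a + d} = {a, a + d})}"

definition Delta :: "('a, 'b) monoid_scheme \<Rightarrow> 'a set \<Rightarrow> nat set" where
  "Delta G G0 = (\<Union>A \<in> product_one_seqs G G0. distances (lengths G G0 A))"

definition Delta_star :: "('a, 'b) monoid_scheme \<Rightarrow> nat set" where
  "Delta_star G = {(LEAST d. d \<in> Delta G G0) | G0. G0 \<subseteq> carrier G \<and> Delta G G0 \<noteq> {}}"

text \<open>Dihedral of order \<open>2n\<close>: the group \<open>\<langle>a, b | a\<^sup>n = b\<^sup>2 = 1, b a b\<^sup>-\<^sup>1 = a\<^sup>-\<^sup>1\<rangle>\<close>. A group of order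
  \<open>2n\<close> generated by elements satisfying these relations is a quotient of that group of the same
  order, hence isomorphic to it.\<close>

definition dihedral_group :: "('a, 'b) monoid_scheme \<Rightarrow> nat \<Rightarrow> bool" where
  "dihedral_group G n \<longleftrightarrow> group G \<and> n \<ge> 1 \<and> order G = 2 * n \<and>
     (\<exists>a \<in> carrier G. \<exists>b \<in> carrier G.
        generate G {a, b} = carrier G \<and> group.ord G a = n \<and> group.ord G b = 2 \<and>
        b \<otimes>\<^bsub>G\<^esub> a \<otimes>\<^bsub>G\<^esub> inv\<^bsub>G\<^esub> b = inv\<^bsub>G\<^esub> a)"

end

theory Submission
  imports Defs
begin

text \<open>All length differences over \<open>G0\<close> are multiples of \<open>d = min \<Delta>(G0)\<close>, so \<open>d\<close> is bounded by any
  nonzero length difference and bounded below by congruences satisfied by all atoms. Let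
  \<open>k(S) = \<Sum> 1 / ord x\<close> be the cross number. If it takes a value below \<open>1\<close> on atoms, let \<open>U = g S\<close> be an atom
  minimizing it; \<open>S\<close> has an ordering with product \<open>g\<^bsup>-1\<^esup>\<close>, so \<open>U\<^bsup>n\<^esup> = g\<^bsup>n\<^esup> S\<^bsup>n\<^esup>\<close> with
  \<open>n = ord g\<close> gives \<open>d \<le> n - 2\<close>. Otherwise take an atom \<open>U\<close> with \<open>k(U) > 1\<close>: the sequence \<open>V\<close> with
  \<open>ord x - 1\<close> copies of each term \<open>x\<close> of \<open>U\<close> is product-one, and \<open>U V = \<Prod> x\<^bsup>ord x\<^esup>\<close> gives
  \<open>d \<le> |U| - 2\<close>. Equality makes \<open>V\<close> an atom, and if \<open>|V| \<le> |U|\<close> then \<open>U\<close> consists of involutions; for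
  \<open>|U| = |G|\<close> this forces \<open>G\<close> to be dihedral. Over an odd dihedral group, a set with a rotation and a
  reflection has \<open>d \<le> 2\<close>, and three reflections force a value of \<open>d\<close> below \<open>n - 1\<close> unless \<open>n = 3\<close>.\<close>

section \<open>Lengths and the minimal distance\<close>

text \<open>In a nonabelian group, removing a product-one part from a product-one sequence need not
  leave a product-one sequence, so factors cannot be cancelled freely. Splittings are therefore
  backed by particular orderings: a cyclic rotation that frees one term, a repeated ordering, a
  reversed ordering of inverses, or a contiguous block cut out of a word. In dihedral groups, parity
  statements valid for every ordering at once replace such a choice. The congruences behind the
  lower bounds come from weights: if an integer weight on \<open>G0\<close> gives every atom a total
  congruent to \<open>c\<close> modulo \<open>c * D\<close>, the weight of a sequence determines its
  lengths modulo \<open>D\<close>. The minimal cross number \<open>q\<close> enters the first upper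
  bound because it limits the number of atoms in \<open>S^n\<close>: \<open>k\<close> atoms carry at
  least \<open>k * q\<close> of the available \<open>n * q - 1\<close>, and \<open>q < 1\<close>
  then forces \<open>k < n - 1\<close>.\<close>

lemma lengths_add:
  assumes "k \<in> lengths G G0 A" "l \<in> lengths G G0 B"
  shows "k + l \<in> lengths G G0 (A + B)"
proof -
  obtain F F' where "set_mset F \<subseteq> atoms G G0" "size F = k" "\<Sum>\<^sub># F = A"
    "set_mset F' \<subseteq> atoms G G0" "size F' = l" "\<Sum>\<^sub># F' = B"
    using assms unfolding lengths_def by blast
  then show ?thesis
    unfolding lengths_def by (auto intro!: exI[of _ "F + F'"])
qed

lemma lengths_empty: "0 \<in> lengths G G0 {#}"
  unfolding lengths_def by (auto intro: exI[of _ "{#}"])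

lemma lengths_repeat_mset:
  "k \<in> lengths G G0 A \<Longrightarrow> n * k \<in> lengths G G0 (repeat_mset n A)"
  by (induction n) (auto intro: lengths_add simp: lengths_empty)

lemma lengths_atom: "U \<in> atoms G G0 \<Longrightarrow> 1 \<in> lengths G G0 U"
  unfolding lengths_def by (auto intro!: exI[of _ "{#U#}"])

lemma lengths_atom_power: "U \<in> atoms G G0 \<Longrightarrow> n \<in> lengths G G0 (repeat_mset n U)"
  using lengths_repeat_mset[OF lengths_atom] by fastforce

lemma lengths_size_image:
  assumes "\<And>x. x \<in># M \<Longrightarrow> f x \<in> atoms G G0"
  shows "size M \<in> lengths G G0 (\<Sum>x\<in>#M. f x)"
  using assms unfolding lengths_def by (auto intro!: exI[of _ "image_mset f M"])

text \<open>A factorization of \<open>A\<close> into \<open>m\<close> atoms makes the weight of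
  \<open>A\<close> congruent to \<open>c * m\<close> modulo \<open>c * D\<close>; two factorizations
  are compared and \<open>c\<close> is cancelled. This is the source of the lower bounds for
  distances.\<close>

lemma lengths_functional:
  fixes f :: "'a \<Rightarrow> int"
  assumes f: "\<And>W. W \<in> atoms G G0 \<Longrightarrow> c * D dvd (\<Sum>x\<in>#W. f x) - c" and "c \<noteq> 0"
    and kl: "k \<in> lengths G G0 A" "l \<in> lengths G G0 A"
  shows "D dvd int k - int l"
proof -
  have *: "c * D dvd (\<Sum>x\<in>#A. f x) - c * int m" if m: "m \<in> lengths G G0 A" for m
  proof -
    obtain F where F: "set_mset F \<subseteq> atoms G G0" "size F = m" "\<Sum>\<^sub># F = A"
      using m unfolding lengths_def by blast
    have "c * D dvd (\<Sum>x\<in>#(\<Sum>\<^sub># F). f x) - c * int (size F)"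
      using F(1)
    proof (induction F)
      case (add W F)
      have "c * D dvd ((\<Sum>x\<in>#W. f x) - c) + ((\<Sum>x\<in>#(\<Sum>\<^sub># F). f x) - c * int (size F))"
        by (intro dvd_add) (use add f in auto)
      then show ?case by (simp add: algebra_simps)
    qed simp
    with F show ?thesis by simp
  qed
  have "c * D dvd ((\<Sum>x\<in>#A. f x) - c * int l) - ((\<Sum>x\<in>#A. f x) - c * int k)"
    by (intro dvd_diff *) (use kl in auto)
  then have "c * D dvd c * (int k - int l)" by (simp add: algebra_simps)
  with \<open>c \<noteq> 0\<close> show ?thesis by simp
qed

text \<open>\<open>LEAST\<close> is unspecified when there are no distances. The divisibility lemma
  below stays true in that case, because all lengths of a sequence coincide.\<close>

abbreviation min_distance :: "('a, 'b) monoid_scheme \<Rightarrow> 'a set \<Rightarrow> nat" where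
  "min_distance G G0 \<equiv> LEAST d. d \<in> Delta G G0"

context group
begin

section \<open>Ordered products and product-one sequences\<close>

abbreviation lprod :: "'a list \<Rightarrow> 'a" where
  "lprod xs \<equiv> foldr (\<otimes>) xs \<one>"

lemma lprod_closed [intro, simp]: "set xs \<subseteq> carrier G \<Longrightarrow> lprod xs \<in> carrier G"
  by (induction xs) auto

lemma lprod_append:
  "set xs \<subseteq> carrier G \<Longrightarrow> set ys \<subseteq> carrier G \<Longrightarrow> lprod (xs @ ys) = lprod xs \<otimes> lprod ys"
  by (induction xs) (auto simp: m_assoc)

text \<open>\<open>foldr_append\<close> would produce folds with a start value other than the
  identity, which the facts on \<open>lprod\<close> do not match.\<close>

declare foldr_append [simp del] lprod_append [simp]

lemma lprod_replicate: "g \<in> carrier G \<Longrightarrow> lprod (replicate n g) = g [^] n"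
  by (induction n) (auto simp flip: nat_pow_Suc2)

lemma lprod_concat_replicate:
  assumes "set xs \<subseteq> carrier G"
  shows "lprod (concat (replicate n xs)) = lprod xs [^] n"
proof (induction n)
  case (Suc n)
  have "set (concat (replicate n xs)) \<subseteq> carrier G" using assms by (induction n) auto
  then have "lprod (concat (replicate (Suc n) xs)) = lprod xs \<otimes> lprod xs [^] n"
    using Suc assms by simp
  then show ?case using nat_pow_Suc2[of "lprod xs" n] assms by simp
qed simp

lemma lprod_rev_inv:
  "set xs \<subseteq> carrier G \<Longrightarrow> lprod (rev (map (\<lambda>x. inv x) xs)) = inv (lprod xs)"
proof (induction xs)
  case (Cons x xs)
  then have "lprod (rev (map (\<lambda>x. inv x) xs) @ [inv x]) = lprod (rev (map (\<lambda>x. inv x) xs)) \<otimes> inv x"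
    by (subst lprod_append) auto
  with Cons show ?case by (simp add: inv_mult_group)
qed simp

lemma product_oneI: "lprod xs = \<one> \<Longrightarrow> mset xs = S \<Longrightarrow> product_one G S"
  unfolding product_one_def by blast

lemma product_one_empty [simp]: "product_one G {#}"
  by (rule product_oneI[of "[]"]) auto

lemma product_one_add:
  assumes "product_one G B" "product_one G C" "set_mset B \<subseteq> carrier G" "set_mset C \<subseteq> carrier G"
  shows "product_one G (B + C)"
proof -
  obtain xs ys where "mset xs = B" "lprod xs = \<one>" "mset ys = C" "lprod ys = \<one>"
    using assms unfolding product_one_def by blast
  with assms show ?thesis
    by (intro product_oneI[of "xs @ ys"]) auto
qed

text \<open>A one-sided inverse in a group is two-sided, so \<open>u v = 1\<close> gives
  \<open>v u = 1\<close>.\<close>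

lemma product_one_rotate:
  assumes "lprod (xs @ ys) = \<one>" "set xs \<subseteq> carrier G" "set ys \<subseteq> carrier G"
  shows "lprod (ys @ xs) = \<one>"
proof -
  have "lprod xs \<otimes> lprod ys = \<one>" using assms by simp
  then have "lprod ys \<otimes> lprod xs = \<one>" using assms inv_comm by auto
  then show ?thesis using assms by simp
qed

text \<open>Rotating the word until it starts with the chosen \<open>g\<close> leaves an ordering of
  the other terms with product \<open>inv g\<close>. This much of cancellation survives
  noncommutativity.\<close>

lemma product_one_add_msetE:
  assumes "product_one G (add_mset g S)" "g \<in> carrier G" "set_mset S \<subseteq> carrier G"
  obtains xs where "mset xs = S" "g \<otimes> lprod xs = \<one>"
proof -
  obtain zs where zs: "mset zs = add_mset g S" "lprod zs = \<one>"
    using assms(1) unfolding product_one_def by blast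
  then have "g \<in> set zs" by (metis set_mset_mset union_single_eq_member)
  then obtain us vs where uv: "zs = us @ g # vs" by (meson split_list)
  have "mset us + mset vs = S" using zs(1) by (simp add: uv)
  then have S: "mset (vs @ us) = S" unfolding mset_append by (subst union_commute)
  have "set (vs @ us) \<subseteq> carrier G" using assms(3) unfolding S[symmetric] by simp
  then have "lprod ((g # vs) @ us) = \<one>"
    using zs(2) assms(2) unfolding uv by - (rule product_one_rotate, auto)
  then show thesis using that[OF S] by simp
qed

lemma product_one_insert_one:
  assumes "set_mset S \<subseteq> carrier G"
  shows "product_one G (add_mset \<one> S) \<longleftrightarrow> product_one G S"
proof
  assume "product_one G (add_mset \<one> S)"
  then obtain xs where "mset xs = S" "\<one> \<otimes> lprod xs = \<one>"
    using assms by (elim product_one_add_msetE) auto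
  then show "product_one G S" using assms by (intro product_oneI[of xs]) auto
next
  assume "product_one G S"
  then obtain xs where "mset xs = S" "lprod xs = \<one>" unfolding product_one_def by blast
  then show "product_one G (add_mset \<one> S)" by (intro product_oneI[of "\<one> # xs"]) auto
qed

lemma product_one_single: "g \<in> carrier G \<Longrightarrow> product_one G {#g#} \<longleftrightarrow> g = \<one>"
  unfolding product_one_def by (auto intro: exI[of _ "[g]"])

lemma product_one_pair:
  assumes "g \<in> carrier G" "h \<in> carrier G"
  shows "product_one G {#g, h#} \<longleftrightarrow> g \<otimes> h = \<one>"
proof
  assume "product_one G {#g, h#}"
  then obtain xs where "mset xs = {#h#}" "g \<otimes> lprod xs = \<one>"
    using assms by (elim product_one_add_msetE) auto
  then show "g \<otimes> h = \<one>" using assms by auto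
qed (use assms in \<open>auto intro!: product_oneI[of "[g, h]"]\<close>)

lemma mset_eq_replicate_mset: "mset xs = replicate_mset n g \<Longrightarrow> xs = replicate n g"
proof (rule replicate_eqI)
  assume eq: "mset xs = replicate_mset n g"
  show "length xs = n" using arg_cong[OF eq, of size] by simp
  show "x = g" if "x \<in> set xs" for x
    using that arg_cong[OF eq, of set_mset] by (simp split: if_splits)
qed

lemma product_one_replicate_mset:
  assumes "g \<in> carrier G"
  shows "product_one G (replicate_mset n g) \<longleftrightarrow> ord g dvd n"
proof -
  have "product_one G (replicate_mset n g) \<longleftrightarrow> lprod (replicate n g) = \<one>"
    unfolding product_one_def using mset_eq_replicate_mset by (metis mset_replicate)
  also have "\<dots> \<longleftrightarrow> g [^] n = \<one>" using assms by (simp only: lprod_replicate)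
  finally show ?thesis using assms pow_eq_id by simp
qed

text \<open>Parts of a sequence over \<open>G0\<close> are again over \<open>G0\<close>. Being an
  atom thus depends on \<open>G0\<close> only through the support, which makes
  \<open>atoms_mono\<close> immediate.\<close>

lemma atoms_iff:
  "U \<in> atoms G G0 \<longleftrightarrow> set_mset U \<subseteq> G0 \<and> U \<noteq> {#} \<and> product_one G U \<and>
     (\<forall>B C. U = B + C \<longrightarrow> product_one G B \<longrightarrow> product_one G C \<longrightarrow> B = {#} \<or> C = {#})"
  (is "_ \<longleftrightarrow> ?R")
proof
  assume U: "U \<in> atoms G G0"
  have "B = {#} \<or> C = {#}" if BC: "U = B + C" "product_one G B" "product_one G C" for B C
  proof (rule ccontr)
    assume "\<not> (B = {#} \<or> C = {#})"
    moreover have "B \<in> product_one_seqs G G0" "C \<in> product_one_seqs G G0"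
      using U BC by (auto simp: atoms_def product_one_seqs_def)
    ultimately show False using U BC(1) unfolding atoms_def by blast
  qed
  then show ?R using U by (auto simp: atoms_def product_one_seqs_def)
next
  assume ?R
  then show "U \<in> atoms G G0"
    unfolding atoms_def product_one_seqs_def by blast
qed

lemma atoms_subset: "U \<in> atoms G G0 \<Longrightarrow> set_mset U \<subseteq> G0"
  by (simp add: atoms_iff)

lemma atoms_mono: "U \<in> atoms G G0 \<Longrightarrow> set_mset U \<subseteq> G1 \<Longrightarrow> U \<in> atoms G G1"
  by (simp add: atoms_iff)

lemma atom_split:
  "U \<in> atoms G G0 \<Longrightarrow> U = B + C \<Longrightarrow> product_one G B \<Longrightarrow> product_one G C \<Longrightarrow> B \<noteq> {#} \<Longrightarrow> C = {#}"
  unfolding atoms_iff by blast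

lemma atom_one:
  assumes "U \<in> atoms G G0" "\<one> \<in># U" "G0 \<subseteq> carrier G"
  shows "U = {#\<one>#}"
proof -
  obtain S where S: "U = add_mset \<one> S" using assms(2) by (meson multi_member_split)
  have "set_mset S \<subseteq> carrier G" using S assms atoms_subset by fastforce
  then have "product_one G S" using S assms by (auto simp: atoms_iff product_one_insert_one)
  then have "S = {#}"
    using atom_split[of U G0 "{#\<one>#}" S] S assms by (auto simp: product_one_single)
  with S show ?thesis by simp
qed

lemma ex_factorization:
  assumes "product_one G A" "set_mset A \<subseteq> G0"
  shows "\<exists>F. set_mset F \<subseteq> atoms G G0 \<and> \<Sum>\<^sub># F = A"
  using assms
proof (induction "size A" arbitrary: A rule: less_induct)
  case less
  show ?case
  proof (cases "A = {#} \<or> A \<in> atoms G G0")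
    case True
    then show ?thesis by (auto intro: exI[of _ "{#}"] exI[of _ "{#A#}"])
  next
    case False
    then obtain B C where BC: "A = B + C" "product_one G B" "product_one G C" "B \<noteq> {#}" "C \<noteq> {#}"
      using less.prems by (auto simp: atoms_iff)
    then have "size B < size A" "size C < size A" by (auto simp: nonempty_has_size)
    then obtain F F' where "set_mset F \<subseteq> atoms G G0" "\<Sum>\<^sub># F = B" "set_mset F' \<subseteq> atoms G G0" "\<Sum>\<^sub># F' = C"
      using less BC by (metis le_sup_iff set_mset_union)
    with BC show ?thesis by (intro exI[of _ "F + F'"]) auto
  qed
qed

lemma ex_length:
  "product_one G A \<Longrightarrow> set_mset A \<subseteq> G0 \<Longrightarrow> \<exists>k. k \<in> lengths G G0 A"
  using ex_factorization[of A G0] unfolding lengths_def by blast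

lemma lengths_pos: "k \<in> lengths G G0 A \<Longrightarrow> A \<noteq> {#} \<Longrightarrow> k \<ge> 1"
  unfolding lengths_def by (auto simp: Suc_le_eq simp flip: nonempty_has_size)

lemma product_one_seqs_add:
  assumes "B \<in> product_one_seqs G G0" "C \<in> product_one_seqs G G0" "G0 \<subseteq> carrier G"
  shows "B + C \<in> product_one_seqs G G0"
proof -
  have "set_mset B \<subseteq> carrier G" "set_mset C \<subseteq> carrier G"
    using assms unfolding product_one_seqs_def by auto
  with assms show ?thesis by (simp add: product_one_seqs_def product_one_add)
qed

lemma lengths_imp_seqs:
  assumes "k \<in> lengths G G0 A" "G0 \<subseteq> carrier G"
  shows "A \<in> product_one_seqs G G0"
proof -
  obtain F where F: "set_mset F \<subseteq> atoms G G0" "\<Sum>\<^sub># F = A"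
    using assms unfolding lengths_def by blast
  have "\<Sum>\<^sub># F \<in> product_one_seqs G G0"
    using F(1)
  proof (induction F)
    case (add W F)
    then show ?case using assms(2) by (auto simp: atoms_def intro!: product_one_seqs_add)
  qed (simp add: product_one_seqs_def)
  with F show ?thesis by simp
qed

text \<open>No length can lie strictly between \<open>k\<close> and \<open>k + e\<close>, as it
  would realize a smaller positive difference. The least difference between any two lengths,
  consecutive or not, is therefore the least distance.\<close>

lemma least_length_difference:
  assumes "k \<in> lengths G G0 A" "k + e \<in> lengths G G0 A" "e \<ge> 1" "G0 \<subseteq> carrier G"
    and least: "\<And>B l e'. l \<in> lengths G G0 B \<Longrightarrow> l + e' \<in> lengths G G0 B \<Longrightarrow> e' \<ge> 1 \<Longrightarrow> e \<le> e'"
  shows "e \<in> Delta G G0" "min_distance G G0 = e"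
proof -
  have "m \<in> {k, k + e}" if "m \<in> lengths G G0 A \<inter> {k..k + e}" for m
    using least[OF assms(1), of "m - k"] that by fastforce
  then have "lengths G G0 A \<inter> {k..k + e} = {k, k + e}"
    using assms(1,2) by (intro equalityI subsetI) auto
  with assms(1-4) show *: "e \<in> Delta G G0"
    unfolding Delta_def distances_def using lengths_imp_seqs by blast
  have "e \<le> e'" if "e' \<in> Delta G G0" for e'
  proof -
    from that obtain B l where "l \<in> lengths G G0 B" "lengths G G0 B \<inter> {l..l + e'} = {l, l + e'}" "e' \<ge> 1"
      unfolding Delta_def distances_def by blast
    then show ?thesis by (intro least) auto
  qed
  with * show "min_distance G G0 = e" by (intro Least_equality)
qed

lemma min_distance_properties:
  assumes "G0 \<subseteq> carrier G" "Delta G G0 \<noteq> {}"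
  obtains A k where "k \<in> lengths G G0 A" "k + min_distance G G0 \<in> lengths G G0 A"
    "min_distance G G0 \<ge> 1"
    "\<forall>B l e. l \<in> lengths G G0 B \<longrightarrow> l + e \<in> lengths G G0 B \<longrightarrow> e \<ge> 1 \<longrightarrow> min_distance G G0 \<le> e"
proof -
  \<comment> \<open>Arbitrary differences of lengths are minimized because these, unlike distances
    between neighbours, persist when further sequences are added.\<close>
  define P where "P e \<longleftrightarrow> e \<ge> 1 \<and> (\<exists>A k. k \<in> lengths G G0 A \<and> k + e \<in> lengths G G0 A)" for e
  obtain e where "e \<in> Delta G G0" using assms by blast
  then have "P e" unfolding P_def Delta_def distances_def by blast
  then have 1: "P (Least P)" by (rule LeastI)
  have 2: "Least P \<le> e" if "P e" for e using that by (rule Least_le)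
  obtain A k where A: "k \<in> lengths G G0 A" "k + Least P \<in> lengths G G0 A" "Least P \<ge> 1"
    using 1 unfolding P_def by blast
  have 3: "\<And>B l e. l \<in> lengths G G0 B \<Longrightarrow> l + e \<in> lengths G G0 B \<Longrightarrow> e \<ge> 1 \<Longrightarrow> Least P \<le> e"
    using 2 unfolding P_def by blast
  have eq: "min_distance G G0 = Least P"
    using least_length_difference(2)[OF A assms(1) 3] .
  show thesis by (rule that[unfolded eq, OF A]) (use 3 in blast)
qed

lemma Delta_nonemptyI:
  assumes "k \<in> lengths G G0 A" "l \<in> lengths G G0 A" "k \<noteq> l" "G0 \<subseteq> carrier G"
  shows "Delta G G0 \<noteq> {}"
proof -
  define P where "P e \<longleftrightarrow> e \<ge> 1 \<and> (\<exists>A k. k \<in> lengths G G0 A \<and> k + e \<in> lengths G G0 A)" for e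
  have "P (max k l - min k l)"
    using assms(1-3) unfolding P_def
    by (intro conjI exI[of _ A] exI[of _ "min k l"]) (auto simp: max_def min_def)
  then have 1: "P (Least P)" by (rule LeastI)
  have 2: "Least P \<le> e" if "P e" for e using that by (rule Least_le)
  obtain B m where B: "m \<in> lengths G G0 B" "m + Least P \<in> lengths G G0 B" "Least P \<ge> 1"
    using 1 unfolding P_def by blast
  have "Least P \<in> Delta G G0"
    by (rule least_length_difference(1)[OF B assms(4)]) (use 2 in \<open>auto simp: P_def\<close>)
  then show ?thesis by blast
qed

text \<open>Division with remainder: a difference \<open>e = q * d + r\<close> is lowered to
  \<open>r\<close> by adding \<open>q\<close> copies of a sequence with lengths \<open>m\<close> and
  \<open>m + d\<close>, factored the long way on one side and the short way on the other.\<close>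

lemma min_distance_dvd:
  assumes G0: "G0 \<subseteq> carrier G" and kl: "k \<in> lengths G G0 B" "l \<in> lengths G G0 B"
  shows "int (min_distance G G0) dvd int k - int l"
proof (cases "k = l")
  case False
  then have ne: "Delta G G0 \<noteq> {}" using Delta_nonemptyI kl G0 by blast
  let ?d = "min_distance G G0"
  obtain A m where A: "m \<in> lengths G G0 A" "m + ?d \<in> lengths G G0 A" "?d \<ge> 1"
    and least: "\<forall>B l e. l \<in> lengths G G0 B \<longrightarrow> l + e \<in> lengths G G0 B \<longrightarrow> e \<ge> 1 \<longrightarrow> ?d \<le> e"
    by (rule min_distance_properties[OF G0 ne])
  have *: "?d dvd e" if ie: "i \<in> lengths G G0 B" "i + e \<in> lengths G G0 B" for i e
  proof (rule ccontr)
    assume ndvd: "\<not> ?d dvd e"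
    define q r where "q = e div ?d" and "r = e mod ?d"
    have e: "e = q * ?d + r" unfolding q_def r_def by simp
    have r: "1 \<le> r" "r < ?d" using ndvd A(3) unfolding r_def by (auto simp: Suc_le_eq mod_greater_zero_iff_not_dvd)
    have 1: "i + q * (m + ?d) \<in> lengths G G0 (B + repeat_mset q A)"
      by (intro lengths_add lengths_repeat_mset ie A)
    have "(i + e) + q * m \<in> lengths G G0 (B + repeat_mset q A)"
      by (intro lengths_add lengths_repeat_mset ie A)
    moreover have "(i + e) + q * m = i + q * (m + ?d) + r"
      unfolding e by (simp add: algebra_simps)
    ultimately have "i + q * (m + ?d) + r \<in> lengths G G0 (B + repeat_mset q A)"
      by (simp only:)
    with least 1 r(1) have "?d \<le> r" by blast
    with r(2) show False by simp
  qed
  show ?thesis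
  proof (cases "k \<le> l")
    case True
    then have "int ?d dvd int (l - k)" using *[of k "l - k"] kl by (subst of_nat_dvd_iff) simp
    then show ?thesis unfolding of_nat_diff[OF True] by (subst dvd_diff_commute)
  next
    case False
    then have "int ?d dvd int (k - l)" using *[of l "k - l"] kl by (subst of_nat_dvd_iff) simp
    then show ?thesis using False by (simp only: of_nat_diff)
  qed
qed auto

lemma min_distance_le:
  assumes "G0 \<subseteq> carrier G" "k \<in> lengths G G0 B" "l \<in> lengths G G0 B" "k < l"
  shows "min_distance G G0 \<le> l - k"
proof -
  have "int (min_distance G G0) dvd int (l - k)"
    using min_distance_dvd[OF assms(1,3,2)] unfolding of_nat_diff[OF less_imp_le[OF assms(4)]] .
  then show ?thesis using assms(4) unfolding of_nat_dvd_iff by (intro dvd_imp_le) auto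
qed

lemma Delta_starI:
  assumes G0: "G0 \<subseteq> carrier G" and k: "k \<in> lengths G G0 A" "k + D \<in> lengths G G0 A" and "D \<ge> 1"
    and dvd: "\<And>B i j. i \<in> lengths G G0 B \<Longrightarrow> j \<in> lengths G G0 B \<Longrightarrow> int D dvd int i - int j"
  shows "D \<in> Delta_star G"
proof -
  have "D \<le> e" if "i \<in> lengths G G0 B" "i + e \<in> lengths G G0 B" "e \<ge> 1" for B i e
    using dvd[OF that(2,1)] that(3) by (auto simp: Suc_le_eq dest: dvd_imp_le)
  then have "D \<in> Delta G G0" "min_distance G G0 = D"
    using least_length_difference[OF k \<open>D \<ge> 1\<close> G0] by blast+
  with G0 show ?thesis unfolding Delta_star_def by blast
qed

lemma Delta_starE:
  assumes "d \<in> Delta_star G"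
  obtains G0 where "G0 \<subseteq> carrier G" "Delta G G0 \<noteq> {}" "min_distance G G0 = d"
  using assms unfolding Delta_star_def by auto

end

section \<open>Atoms of finite groups and cross numbers\<close>

locale finite_group = group +
  assumes finite_carrier: "finite (carrier G)"
begin

lemma ord_pos: "g \<in> carrier G \<Longrightarrow> ord g \<ge> 1"
  using ord_ge_1 finite_carrier by blast

text \<open>Between two equal prefix products lies a block with product one. Cutting out a
  contiguous block leaves the product of the rest unchanged, so the atom would split. The full
  product is outside the range because it repeats the empty one.\<close>

lemma atom_prefix_products_inj:
  assumes U: "mset xs \<in> atoms G G0" "G0 \<subseteq> carrier G" and one: "lprod xs = \<one>"
  shows "inj_on (\<lambda>i. lprod (take i xs)) {..<length xs}"
proof (rule linorder_inj_onI)
  fix i j assume ij: "i < j" "i \<in> {..<length xs}" "j \<in> {..<length xs}"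
  define as ms cs where "as = take i xs" and "ms = drop i (take j xs)" and "cs = drop j xs"
  have asms: "take j xs = as @ ms"
    using append_take_drop_id[of i "take j xs"] ij(1) unfolding as_def ms_def by (simp add: min_def)
  have xs: "xs = as @ ms @ cs"
    using append_take_drop_id[of j xs] unfolding asms cs_def by simp
  have c: "set as \<subseteq> carrier G" "set ms \<subseteq> carrier G" "set cs \<subseteq> carrier G"
    using atoms_subset[OF U(1)] U(2) unfolding xs by auto
  have ne: "ms \<noteq> []" "cs \<noteq> []" using ij unfolding ms_def cs_def by auto
  have "lprod as \<noteq> lprod (as @ ms)"
  proof
    assume "lprod as = lprod (as @ ms)"
    then have "lprod as \<otimes> lprod ms = lprod as \<otimes> \<one>"
      using c by (simp add: lprod_append)
    then have m: "lprod ms = \<one>" using c by simp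
    then have "lprod (as @ cs) = \<one>"
      using one c unfolding xs by (simp add: lprod_append)
    then have "product_one G (mset (as @ cs))" using product_oneI by blast
    moreover have "product_one G (mset ms)" using m product_oneI by blast
    moreover have "mset xs = mset ms + mset (as @ cs)" unfolding xs by simp
    moreover have "mset ms \<noteq> {#}" using ne by simp
    ultimately have "mset (as @ cs) = {#}" using atom_split[OF U(1)] by blast
    then show False using ne by simp
  qed
  then show "lprod (take i xs) \<noteq> lprod (take j xs)" unfolding asms as_def .
qed auto

text \<open>The bound is formulated for a subgroup because sets of rotations later need
  \<open>n\<close> rather than the full order \<open>2 * n\<close>.\<close>

lemma size_atom_le_card:
  assumes U: "U \<in> atoms G G0" and G0: "G0 \<subseteq> H" and H: "subgroup H G"
  shows "size U \<le> card H"
proof -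
  obtain xs where xs: "mset xs = U" "lprod xs = \<one>"
    using U unfolding atoms_iff product_one_def by blast
  have HG: "H \<subseteq> carrier G" using H subgroup.subset by blast
  have inj: "inj_on (\<lambda>i. lprod (take i xs)) {..<length xs}"
    using U G0 HG xs by (intro atom_prefix_products_inj[of xs G0]) auto
  have "lprod ys \<in> H" if "set ys \<subseteq> H" for ys
    using that by (induction ys) (auto simp: subgroup.one_closed[OF H] subgroup.m_closed[OF H])
  moreover have "set xs \<subseteq> H" using atoms_subset[OF U] G0 xs(1) by auto
  then have "set (take i xs) \<subseteq> H" for i using set_take_subset[of i xs] by blast
  ultimately have "(\<lambda>i. lprod (take i xs)) ` {..<length xs} \<subseteq> H" by blast
  moreover have "finite H" using HG finite_carrier finite_subset by blast
  ultimately have "card {..<length xs} \<le> card H" using inj card_inj_on_le by blast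
  then show ?thesis using xs(1) by auto
qed

lemma size_atom_le_order:
  "U \<in> atoms G G0 \<Longrightarrow> G0 \<subseteq> carrier G \<Longrightarrow> size U \<le> order G"
  using size_atom_le_card subgroup_self by (auto simp: order_def)

lemma finite_atoms:
  assumes "G0 \<subseteq> carrier G" shows "finite (atoms G G0)"
proof -
  have "atoms G G0 \<subseteq> mset ` {xs. set xs \<subseteq> carrier G \<and> length xs \<le> order G}"
  proof
    fix U assume U: "U \<in> atoms G G0"
    obtain xs where "mset xs = U" using ex_mset by blast
    with U show "U \<in> mset ` {xs. set xs \<subseteq> carrier G \<and> length xs \<le> order G}"
      using size_atom_le_order[OF U assms] atoms_subset[OF U] assms by auto
  qed
  then show ?thesis using finite_lists_length_le[OF finite_carrier] finite_surj by blast
qed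

lemma size_atom_le_davenport:
  assumes "U \<in> atoms G G0" "G0 \<subseteq> carrier G" shows "size U \<le> davenport G G0"
  unfolding davenport_def using finite_atoms assms by (intro Max_ge) auto

lemma davenport_le:
  assumes "U \<in> atoms G G0" "G0 \<subseteq> carrier G" "\<And>W. W \<in> atoms G G0 \<Longrightarrow> size W \<le> N"
  shows "davenport G G0 \<le> N"
  unfolding davenport_def using finite_atoms assms by (subst Max_le_iff) auto

text \<open>A product-one part of such a sequence that misses the distinguished term is a proper
  power of \<open>g\<close>, hence not product-one.\<close>

lemma atom_add_replicate:
  assumes g: "g \<in> carrier G" and one: "product_one G (add_mset y (replicate_mset i g))"
    and i: "i < ord g"
  shows "add_mset y (replicate_mset i g) \<in> atoms G (insert y {g})"
proof -
  have key: "B = {#}" if "B \<subseteq># replicate_mset i g" "product_one G B" for B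
  proof -
    obtain j where j: "B = replicate_mset j g" "j \<le> i"
      using \<open>B \<subseteq># replicate_mset i g\<close> by (metis msubseteq_replicate_msetE)
    then have "ord g dvd j" using that(2) g by (simp add: product_one_replicate_mset)
    with j i have "j = 0" by (auto dest: dvd_imp_le)
    with j show ?thesis by simp
  qed
  have "B = {#} \<or> C = {#}"
    if BC: "add_mset y (replicate_mset i g) = B + C" "product_one G B" "product_one G C" for B C
  proof -
    have "y \<in># B \<or> y \<in># C" using BC(1) by (metis union_iff union_single_eq_member)
    then show ?thesis
    proof
      assume "y \<in># B"
      then obtain B' where "B = add_mset y B'" by (meson multi_member_split)
      then have "C \<subseteq># replicate_mset i g" using BC(1) by auto
      then show ?thesis using key BC(3) by blast
    next
      assume "y \<in># C"
      then obtain C' where "C = add_mset y C'" by (meson multi_member_split)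
      then have "B \<subseteq># replicate_mset i g" using BC(1) by auto
      then show ?thesis using key BC(2) by blast
    qed
  qed
  then show ?thesis using one by (auto simp: atoms_iff)
qed

lemma atom_ord_power:
  assumes g: "g \<in> carrier G" shows "replicate_mset (ord g) g \<in> atoms G {g}"
proof -
  have "ord g = Suc (ord g - 1)" using ord_pos[OF g] by simp
  then have eq: "replicate_mset (ord g) g = add_mset g (replicate_mset (ord g - 1) g)"
    by (metis replicate_mset_Suc)
  have "product_one G (replicate_mset (ord g) g)" using g by (simp add: product_one_replicate_mset)
  then show ?thesis using atom_add_replicate[OF g, of g "ord g - 1"] ord_pos[OF g] unfolding eq by simp
qed

lemma atom_ord_power': "g \<in> carrier G \<Longrightarrow> g \<in> G0 \<Longrightarrow> replicate_mset (ord g) g \<in> atoms G G0"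
  by (rule atoms_mono[OF atom_ord_power]) auto

section \<open>Cross numbers\<close>

definition cross_number :: "'a multiset \<Rightarrow> real" where
  "cross_number S = (\<Sum>x\<in>#S. 1 / real (ord x))"

lemma cross_number_add [simp]: "cross_number (B + C) = cross_number B + cross_number C"
  by (simp add: cross_number_def)

lemma cross_number_repeat_mset [simp]: "cross_number (repeat_mset n B) = real n * cross_number B"
  by (induction n) (auto simp: cross_number_def algebra_simps)

lemma cross_number_ord_power [simp]:
  "g \<in> carrier G \<Longrightarrow> cross_number (replicate_mset (ord g) g) = 1"
  using ord_pos[of g] by (simp add: cross_number_def)

lemma cross_number_sum_mset: "cross_number (\<Sum>\<^sub># F) = (\<Sum>W\<in>#F. cross_number W)"
  by (induction F) (auto simp: cross_number_def)

lemma cross_number_pos: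
  assumes "set_mset S \<subseteq> carrier G" "S \<noteq> {#}" shows "cross_number S > 0"
  using assms
proof (induction S)
  case (add x S)
  then have "1 / real (ord x) > 0" "cross_number S \<ge> 0"
    using ord_pos[of x] by (cases "S = {#}"; auto simp: cross_number_def)+
  then show ?case by (simp add: cross_number_def add_pos_nonneg)
qed simp

lemma lengths_cross_number_le:
  assumes k: "k \<in> lengths G G0 A" and q: "\<And>W. W \<in> atoms G G0 \<Longrightarrow> q \<le> cross_number W"
  shows "real k * q \<le> cross_number A"
proof -
  obtain F where F: "set_mset F \<subseteq> atoms G G0" "size F = k" "\<Sum>\<^sub># F = A"
    using k unfolding lengths_def by blast
  have "real (size F) * q \<le> (\<Sum>W\<in>#F. cross_number W)"
    using F(1)
  proof (induction F)
    case (add W F)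
    then show ?case using q[of W] by (simp add: algebra_simps)
  qed simp
  with F show ?thesis by (simp add: cross_number_sum_mset flip: F(3))
qed

text \<open>If all atoms had cross number 1, additivity would make the cross number of
  \<open>A\<close> equal to each of its lengths, leaving no room for a distance.\<close>

lemma ex_cross_number_neq_1:
  assumes "Delta G G0 \<noteq> {}" shows "\<exists>U \<in> atoms G G0. cross_number U \<noteq> 1"
proof (rule ccontr)
  assume *: "\<not> ?thesis"
  have eq: "real k = cross_number A" if k: "k \<in> lengths G G0 A" for k A
  proof -
    obtain F where F: "set_mset F \<subseteq> atoms G G0" "size F = k" "\<Sum>\<^sub># F = A"
      using k unfolding lengths_def by blast
    have "(\<Sum>W\<in>#F. cross_number W) = real (size F)"
      using F(1) by (induction F) (use * in auto)
    with F show ?thesis by (simp add: cross_number_sum_mset flip: F(3))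
  qed
  obtain d A a where "d \<ge> 1" "a \<in> lengths G G0 A" "lengths G G0 A \<inter> {a..a + d} = {a, a + d}"
    using assms unfolding Delta_def distances_def by blast
  then have "real a = cross_number A" "real (a + d) = cross_number A" using eq by blast+
  with \<open>d \<ge> 1\<close> show False by simp
qed

end

section \<open>The two upper bounds for the minimal distance\<close>

lemma mset_concat_replicate: "mset (concat (replicate n xs)) = repeat_mset n (mset xs)"
  by (induction n) auto

lemma set_mset_repeat_mset_subset: "set_mset (repeat_mset n S) \<subseteq> set_mset S"
  by (induction n) auto

context finite_group
begin

lemma min_distance_le_ord:
  assumes G0: "G0 \<subseteq> carrier G" and U: "U \<in> atoms G G0" "cross_number U < 1"
    and min: "\<And>W. W \<in> atoms G G0 \<Longrightarrow> cross_number U \<le> cross_number W"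
    and g: "g \<in># U"
  shows "min_distance G G0 + 2 \<le> ord g"
proof -
  define n where "n = ord g"
  define q where "q = cross_number U"
  obtain S where S: "U = add_mset g S" using g by (meson multi_member_split)
  have G0': "g \<in> G0" "set_mset S \<subseteq> G0" using atoms_subset[OF U(1)] by (auto simp: S)
  then have car: "g \<in> carrier G" "set_mset S \<subseteq> carrier G" using G0 by auto
  have n: "n \<ge> 1" using ord_pos[OF car(1)] by (simp add: n_def)
  have "product_one G (add_mset g S)" using U(1) by (simp add: atoms_iff S)
  then obtain xs where xs: "mset xs = S" "g \<otimes> lprod xs = \<one>"
    using car by (elim product_one_add_msetE)
  have xcar: "set xs \<subseteq> carrier G" using xs(1) car(2) by auto
  have "lprod xs = inv g" using xs(2) car(1) xcar by (metis inv_equality inv_comm lprod_closed)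
  \<comment> \<open>Repeating one fixed ordering turns the product into a power of
    \<open>inv g\<close>, although the terms need not commute.\<close>
  then have "lprod (concat (replicate n xs)) = inv g [^] n"
    using lprod_concat_replicate[OF xcar] by simp
  also have "\<dots> = \<one>" using car(1) by (simp add: n_def nat_pow_inv)
  finally have T: "product_one G (repeat_mset n S)"
    using product_oneI mset_concat_replicate xs(1) by blast
  obtain k where k: "k \<in> lengths G G0 (repeat_mset n S)"
    using ex_length[OF T] set_mset_repeat_mset_subset G0'(2) by blast
  have eq: "repeat_mset n U = replicate_mset n g + repeat_mset n S"
    by (simp add: S)
  \<comment> \<open>A one-term atom is the identity, whose cross number is 1. So \<open>S\<close>
    has terms and its power needs at least one atom, which supplies the second unit subtracted from
    \<open>n\<close>.\<close>
  have "S \<noteq> {#}"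
  proof
    assume "S = {#}"
    then have "U = {#\<one>#}" using U(1) car(1) by (simp add: S atoms_iff product_one_single)
    with U(2) show False by (simp add: cross_number_def)
  qed
  then have "repeat_mset n S \<noteq> {#}" using n by (cases n) auto
  then have k1: "k \<ge> 1" using lengths_pos k by blast
  have "cross_number (repeat_mset n U) = 1 + cross_number (repeat_mset n S)"
    unfolding eq cross_number_add using car(1) by (simp add: n_def)
  then have "cross_number (repeat_mset n S) = real n * q - 1" by (simp add: q_def)
  then have kq: "real k * q \<le> real n * q - 1"
    using lengths_cross_number_le[OF k min] by (simp add: q_def)
  have q: "0 < q" "q < 1"
    using U cross_number_pos[of U] atoms_subset[OF U(1)] G0 by (auto simp: q_def atoms_iff)
  \<comment> \<open>Otherwise \<open>n q <= k q + q <= n q - 1 + q\<close>, contradicting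
    \<open>q < 1\<close>.\<close>
  have "k + 1 < n"
  proof (rule ccontr)
    assume "\<not> k + 1 < n"
    then have "real n \<le> real k + 1" by simp
    then have "real n * q \<le> (real k + 1) * q" using q by (intro mult_right_mono) auto
    with kq q show False by (simp add: algebra_simps)
  qed
  moreover have "n \<in> lengths G G0 (repeat_mset n U)" by (rule lengths_atom_power[OF U(1)])
  moreover have "1 + k \<in> lengths G G0 (repeat_mset n U)"
    unfolding eq using atom_ord_power'[OF car(1) G0'(1)] k
    by (intro lengths_add lengths_atom) (auto simp: n_def)
  ultimately have "min_distance G G0 \<le> n - (1 + k)"
    by (intro min_distance_le[OF G0]) auto
  with \<open>k + 1 < n\<close> k1 show ?thesis by (simp add: n_def)
qed

text \<open>The inverse of a product of terms \<open>g\<close> is a product, in reverse order, of powers \<open>g\<^bsup>ord g - 1\<^esup>\<close>.\<close>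

definition complement_seq :: "'a multiset \<Rightarrow> 'a multiset" where
  "complement_seq U = (\<Sum>x\<in>#U. replicate_mset (ord x - 1) x)"

lemma set_complement_seq: "set_mset (complement_seq U) \<subseteq> set_mset U"
  by (auto simp: complement_seq_def split: if_splits)

lemma product_one_complement_seq:
  assumes "product_one G U" "set_mset U \<subseteq> carrier G"
  shows "product_one G (complement_seq U)"
proof -
  obtain xs where xs: "mset xs = U" "lprod xs = \<one>" using assms unfolding product_one_def by blast
  have pow: "x [^] (ord x - 1) = inv x" if "x \<in> carrier G" for x
  proof -
    have "x [^] (ord x - 1) \<otimes> x = x [^] Suc (ord x - 1)" by simp
    also have "\<dots> = \<one>" using ord_pos[OF that] that by simp
    finally show ?thesis using that by (metis inv_equality nat_pow_closed)
  qed
  have inverse: "lprod (concat (map (\<lambda>x. replicate (ord x - 1) x) ys)) = lprod (map (\<lambda>x. inv x) ys)"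
    if "set ys \<subseteq> carrier G" for ys
    using that
  proof (induction ys)
    case (Cons y ys)
    have "set (concat (map (\<lambda>x. replicate (ord x - 1) x) ys)) \<subseteq> carrier G"
      using Cons.prems by auto
    moreover have "set (replicate (ord y - 1) y) \<subseteq> carrier G" using Cons.prems by auto
    ultimately show ?case
      using Cons pow[of y] by (simp add: lprod_replicate del: foldr_replicate)
  qed simp
  have "lprod (concat (map (\<lambda>x. replicate (ord x - 1) x) (rev xs))) = lprod (rev (map (\<lambda>x. inv x) xs))"
    unfolding rev_map using inverse[of "rev xs"] assms(2) by (simp flip: xs(1))
  also have "\<dots> = \<one>" using assms(2) xs by (subst lprod_rev_inv) auto
  finally have *: "lprod (concat (map (\<lambda>x. replicate (ord x - 1) x) (rev xs))) = \<one>" .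
  have "mset (concat (map (\<lambda>x. replicate (ord x - 1) x) ys)) = complement_seq (mset ys)" for ys
    by (induction ys) (auto simp: complement_seq_def)
  then show ?thesis using product_oneI[OF *] xs(1) by (metis mset_rev)
qed

lemma add_complement_seq:
  assumes "set_mset U \<subseteq> carrier G"
  shows "U + complement_seq U = (\<Sum>x\<in>#U. replicate_mset (ord x) x)"
  using assms
proof (induction U)
  case (add x U)
  have "replicate_mset (ord x) x = add_mset x (replicate_mset (ord x - 1) x)"
    using ord_pos[of x] add.prems by (cases "ord x") auto
  with add show ?case by (simp add: complement_seq_def)
qed (simp add: complement_seq_def)

lemma size_complement_seq: "size (complement_seq U) = (\<Sum>x\<in>#U. ord x - 1)"
  by (induction U) (auto simp: complement_seq_def)

lemma cross_number_ord_powers: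
  "set_mset U \<subseteq> carrier G \<Longrightarrow> cross_number (\<Sum>x\<in>#U. replicate_mset (ord x) x) = real (size U)"
  by (induction U) (auto simp: cross_number_def[of "{#}"])

lemma lengths_ord_powers:
  assumes "set_mset U \<subseteq> G0" "G0 \<subseteq> carrier G"
  shows "size U \<in> lengths G G0 (\<Sum>x\<in>#U. replicate_mset (ord x) x)"
  using assms by (intro lengths_size_image atom_ord_power') auto

text \<open>The cross number of \<open>V\<close> is \<open>|U| - k(U) < |U| - 1\<close>, so
  \<open>V\<close> has fewer than \<open>|U| - 1\<close> atoms and the lengths \<open>1 + k\<close>
  and \<open>|U|\<close> of \<open>U V\<close> differ. If no atom over \<open>G0\<close> exceeds
  \<open>d + 2\<close>, only \<open>k = 1\<close> remains, and \<open>V\<close> is itself an atom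
  subject to that size bound.\<close>

lemma min_distance_le_size:
  assumes G0: "G0 \<subseteq> carrier G" and U: "U \<in> atoms G G0" "cross_number U > 1"
    and ge1: "\<And>W. W \<in> atoms G G0 \<Longrightarrow> cross_number W \<ge> 1"
  shows "min_distance G G0 + 2 \<le> size U"
    and "(\<And>W. W \<in> atoms G G0 \<Longrightarrow> size W \<le> min_distance G G0 + 2) \<Longrightarrow> \<forall>x \<in># U. ord x = 2"
proof -
  define V where "V = complement_seq U"
  have sub: "set_mset U \<subseteq> G0" "set_mset U \<subseteq> carrier G" using atoms_subset[OF U(1)] G0 by auto
  \<comment> \<open>An atom containing the identity consists of it alone and has cross number 1. Its
    absence gives every term a nonempty block in \<open>V\<close>.\<close>
  have one: "\<one> \<notin># U"
  proof
    assume "\<one> \<in># U"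
    then have "U = {#\<one>#}" using atom_one U(1) G0 by blast
    with U(2) show False by (simp add: cross_number_def)
  qed
  have ord2: "ord x - 1 \<ge> 1" if "x \<in># U" for x
  proof -
    have x: "x \<in> carrier G" "x \<noteq> \<one>" using that sub one by auto
    then have "ord x \<noteq> 1" "ord x \<ge> 1" using ord_eq_1 ord_pos by auto
    then show ?thesis by simp
  qed
  have "(\<Sum>x\<in>#S. 1) \<le> (\<Sum>x\<in>#S. ord x - 1)" if "S \<subseteq># U" for S
    using ord2 that by (intro sum_mset_mono) (meson mset_subset_eqD)
  \<comment> \<open>Stated for all parts of \<open>U\<close>, because it is used both for
    \<open>U\<close> and for \<open>U\<close> with one term removed.\<close>
  then have sizes: "size S \<le> size (complement_seq S)" if "S \<subseteq># U" for S
    using that by (simp add: size_complement_seq)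
  have "product_one G V" "set_mset V \<subseteq> G0"
    using U(1) sub set_complement_seq product_one_complement_seq
    unfolding V_def by (auto simp: atoms_iff)
  then obtain k where k: "k \<in> lengths G G0 V" using ex_length by blast
  have "size U > 0" using U(1) by (simp add: atoms_iff nonempty_has_size)
  then have "V \<noteq> {#}" using sizes[of U] unfolding V_def by auto
  then have k1: "k \<ge> 1" using lengths_pos k by blast
  have eq: "U + V = (\<Sum>x\<in>#U. replicate_mset (ord x) x)"
    unfolding V_def using sub by (intro add_complement_seq)
  have "cross_number U + cross_number V = real (size U)"
    using cross_number_ord_powers[OF sub(2)] by (simp flip: eq)
  moreover have "real k \<le> cross_number V" using lengths_cross_number_le[OF k, of 1] ge1 by simp
  ultimately have "1 + k < size U" using U(2) by linarith
  moreover have "size U \<in> lengths G G0 (U + V)" unfolding eq using lengths_ord_powers sub G0 by blast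
  moreover have "1 + k \<in> lengths G G0 (U + V)" using k U(1) by (intro lengths_add lengths_atom)
  ultimately have le: "min_distance G G0 \<le> size U - (1 + k)"
    by (intro min_distance_le[OF G0]) auto
  with \<open>1 + k < size U\<close> k1 show bound: "min_distance G G0 + 2 \<le> size U" by simp
  assume small: "\<And>W. W \<in> atoms G G0 \<Longrightarrow> size W \<le> min_distance G G0 + 2"
  have "size U = min_distance G G0 + 2" using bound small[OF U(1)] by simp
  with le \<open>1 + k < size U\<close> k1 have "k = 1" by simp
  with k obtain F where "set_mset F \<subseteq> atoms G G0" "size F = 1" "\<Sum>\<^sub># F = V"
    unfolding lengths_def by auto
  then have "V \<in> atoms G G0" using size_1_singleton_mset[of F] by auto
  then have sV: "size (complement_seq U) \<le> size U"
    using small \<open>size U = _\<close> by (auto simp: V_def)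
  show "\<forall>x \<in># U. ord x = 2"
  proof
    fix x assume x: "x \<in># U"
    then obtain S where S: "U = add_mset x S" by (meson multi_member_split)
    \<comment> \<open>The remaining terms already contribute at least \<open>|U| - 1\<close> to
      \<open>V\<close>, so \<open>x\<close> contributes at most 1.\<close>
    have "size S \<le> size (complement_seq S)" using sizes[of S] S by simp
    with sV have "ord x - 1 \<le> 1" by (simp add: S complement_seq_def)
    with ord2[OF x] show "ord x = 2" by simp
  qed
qed

text \<open>The least cross number, attained because there are finitely many atoms, selects the
  case. The last clause stays an implication because its premise comes from different bounds in
  different uses: the Davenport constant of the group or its order.\<close>

lemma min_distance_cases:
  assumes G0: "G0 \<subseteq> carrier G" and ne: "Delta G G0 \<noteq> {}"
  obtains (large_order) g where "g \<in> G0" "min_distance G G0 + 2 \<le> ord g"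
  | (large_atom) U where "U \<in> atoms G G0" "min_distance G G0 + 2 \<le> size U"
      "(\<forall>W \<in> atoms G G0. size W \<le> min_distance G G0 + 2) \<longrightarrow> (\<forall>x \<in># U. ord x = 2)"
proof -
  obtain U0 where U0: "U0 \<in> atoms G G0" "cross_number U0 \<noteq> 1"
    using ex_cross_number_neq_1[OF ne] by blast
  have fin: "finite (cross_number ` atoms G G0)" using finite_atoms[OF G0] by simp
  define q where "q = Min (cross_number ` atoms G G0)"
  have "q \<in> cross_number ` atoms G G0" unfolding q_def using fin U0 by (intro Min_in) auto
  then obtain U where U: "U \<in> atoms G G0" "cross_number U = q" by blast
  have min: "q \<le> cross_number W" if "W \<in> atoms G G0" for W
    unfolding q_def using fin that by (intro Min_le) auto
  show thesis
  proof (cases "q < 1")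
    case True
    obtain g where g: "g \<in># U" using U(1) by (auto simp: atoms_iff)
    then have "g \<in> G0" using atoms_subset[OF U(1)] by auto
    moreover have "min_distance G G0 + 2 \<le> ord g"
      using min_distance_le_ord[OF G0 U(1) _ _ g] True U(2) min by simp
    ultimately show thesis by (rule large_order)
  next
    case False
    have ge1: "cross_number W \<ge> 1" if "W \<in> atoms G G0" for W using min[OF that] False by simp
    have gt1: "cross_number U0 > 1" using ge1[OF U0(1)] U0(2) by simp
    show thesis
      using large_atom[OF U0(1)] min_distance_le_size[OF G0 U0(1) gt1 ge1] by blast
  qed
qed

lemma min_distance_le_davenport:
  assumes G0: "G0 \<subseteq> carrier G" and ne: "Delta G G0 \<noteq> {}"
  shows "min_distance G G0 + 2 \<le> davenport G G0"
  using G0 ne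
proof (cases rule: min_distance_cases)
  case (large_order g)
  then have "size (replicate_mset (ord g) g) \<le> davenport G G0"
    using G0 by (intro size_atom_le_davenport atom_ord_power') auto
  with large_order show ?thesis by simp
next
  case (large_atom U)
  then show ?thesis using size_atom_le_davenport[OF _ G0, of U] by simp
qed

text \<open>The atom \<open>U\<close> ensures that the smaller maximum is not taken over an empty
  set.\<close>

lemma davenport_mono:
  assumes "G0 \<subseteq> G1" "G1 \<subseteq> carrier G" "U \<in> atoms G G0"
  shows "davenport G G0 \<le> davenport G G1"
proof (rule davenport_le[OF assms(3)])
  show "G0 \<subseteq> carrier G" using assms by simp
  show "size W \<le> davenport G G1" if "W \<in> atoms G G0" for W
    using that assms atoms_subset[OF that] by (intro size_atom_le_davenport atoms_mono[OF that]) auto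
qed

lemma davenport_le_order: "davenport G (carrier G) \<le> order G"
  by (rule davenport_le[OF atom_ord_power'[of \<one>]]) (auto simp: size_atom_le_order)

text \<open>\<open>W^2\<close> is a product of two atoms \<open>W\<close> and also of
  \<open>|W|\<close> squares of involutions.\<close>

lemma involutive_atom_distance:
  assumes G0: "G0 \<subseteq> carrier G" and W: "W \<in> atoms G G0" "\<forall>x \<in># W. ord x = 2"
  shows "int (min_distance G G0) dvd int (size W) - 2"
proof -
  have "(\<Sum>x\<in>#S. replicate_mset (ord x) x) = repeat_mset 2 S" if "\<forall>x \<in># S. ord x = 2" for S
    using that by (induction S) (auto simp: numeral_2_eq_2)
  then have "size W \<in> lengths G G0 (repeat_mset 2 W)"
    using lengths_ord_powers[of W G0] W atoms_subset G0 by simp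
  moreover have "2 \<in> lengths G G0 (repeat_mset 2 W)" using lengths_atom_power W(1) by blast
  ultimately show ?thesis using min_distance_dvd[OF G0] by fastforce
qed

end

section \<open>Lower bounds\<close>

lemma even_counts_imp_repeat_mset:
  assumes "\<And>z. even (count S z)" shows "\<exists>T. S = repeat_mset 2 T"
proof -
  define T where "T = Abs_multiset (\<lambda>z. count S z div 2)"
  have "{z. 0 < count S z div 2} \<subseteq> set_mset S"
    by (auto simp flip: count_greater_zero_iff intro: gr0I)
  then have "finite {z. 0 < count S z div 2}" by (rule finite_subset) simp
  then have "count T z = count S z div 2" for z unfolding T_def by (simp add: count_Abs_multiset)
  then have "S = repeat_mset 2 T" using assms by (intro multiset_eqI) simp
  then show ?thesis by blast
qed

lemma replicate_mset_add: "replicate_mset (m + n) x = replicate_mset m x + replicate_mset n x"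
  by (rule multiset_eqI) simp

context finite_group
begin

text \<open>Powers of one element commute, so the exponent sum decides for all orderings at
  once.\<close>

lemma product_one_powers_iff:
  fixes e :: "'a \<Rightarrow> int"
  assumes g: "g \<in> carrier G" and S: "\<And>x. x \<in># S \<Longrightarrow> x = g [^] e x"
  shows "product_one G S \<longleftrightarrow> int (ord g) dvd (\<Sum>x\<in>#S. e x)"
proof -
  have *: "lprod xs = g [^] (\<Sum>x\<in>#mset xs. e x)" if "\<forall>x\<in>set xs. x = g [^] e x" for xs
    using that by (induction xs) (use g in \<open>auto simp: int_pow_mult\<close>)
  obtain ys where ys: "mset ys = S" using ex_mset by blast
  have "lprod xs = \<one> \<longleftrightarrow> int (ord g) dvd (\<Sum>x\<in>#S. e x)" if "mset xs = S" for xs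
  proof -
    have "\<forall>x\<in>set xs. x = g [^] e x" using S that by auto
    then have "lprod xs = g [^] (\<Sum>x\<in>#S. e x)" using *[of xs] that by simp
    then show ?thesis using int_pow_eq_id[OF g] by simp
  qed
  with ys show ?thesis unfolding product_one_def by blast
qed

text \<open>At least \<open>ord g\<close> copies occur, and taking out exactly that many leaves a
  product-one sequence, which must be empty.\<close>

lemma atom_single_support:
  assumes W: "W \<in> atoms G G0" "set_mset W \<subseteq> {g}" and g: "g \<in> carrier G"
  shows "W = replicate_mset (ord g) g"
proof -
  obtain i where i: "W = replicate_mset i g"
    using W(2) set_mset_subset_singletonD by metis
  have "W \<noteq> {#}" "product_one G W" using W(1) by (auto simp: atoms_iff)
  then have "ord g dvd i" "i \<noteq> 0" using g unfolding i product_one_replicate_mset[OF g] by auto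
  then have "i = ord g + (i - ord g)" "ord g dvd i - ord g"
    by (auto dest: dvd_imp_le intro: dvd_diff_nat)
  then obtain j where j: "i = ord g + j" "ord g dvd j" by blast
  have "W = replicate_mset (ord g) g + replicate_mset j g"
    unfolding i j by (rule replicate_mset_add)
  moreover have "product_one G (replicate_mset (ord g) g)" "product_one G (replicate_mset j g)"
    using g j(2) by (simp_all add: product_one_replicate_mset)
  moreover have "replicate_mset (ord g) g \<noteq> {#}" using ord_pos[OF g] by (cases "ord g") auto
  ultimately have "replicate_mset j g = {#}" using atom_split[OF W(1)] by blast
  with \<open>W = replicate_mset (ord g) g + replicate_mset j g\<close> show ?thesis by simp
qed

text \<open>If at most three terms are split into two nonempty parts, one part is a single term, and
  a single product-one term is the identity.\<close>

lemma atom_size_le_3: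
  assumes S: "product_one G S" "S \<noteq> {#}" "size S \<le> 3" "set_mset S \<subseteq> carrier G" "\<one> \<notin># S"
  shows "S \<in> atoms G (set_mset S)"
proof -
  have nsingle: "size B \<noteq> 1" if "B \<subseteq># S" "product_one G B" for B
  proof
    assume "size B = 1"
    then obtain x where x: "B = {#x#}" using size_1_singleton_mset by blast
    then have "x \<in># S" using that(1) by simp
    with x that(2) S show False by (auto simp: product_one_single)
  qed
  have "B = {#} \<or> C = {#}" if BC: "S = B + C" "product_one G B" "product_one G C" for B C
  proof -
    have "size B \<noteq> 1" "size C \<noteq> 1" using nsingle BC by auto
    moreover have "size B + size C \<le> 3" using S(3) BC(1) by simp
    ultimately have "size B = 0 \<or> size C = 0" by linarith
    then show ?thesis by simp
  qed
  with S show ?thesis by (simp add: atoms_iff)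
qed

lemma ord_2_iff: "x \<in> carrier G \<Longrightarrow> ord x = 2 \<longleftrightarrow> x \<noteq> \<one> \<and> x \<otimes> x = \<one>"
proof -
  assume x: "x \<in> carrier G"
  have "x \<otimes> x = \<one> \<longleftrightarrow> ord x dvd 2" using pow_eq_id[OF x, of 2] x by (simp add: numeral_2_eq_2)
  moreover have "ord x dvd 2 \<longleftrightarrow> ord x = 1 \<or> ord x = 2"
    using ord_pos[OF x] by (auto dest!: dvd_imp_le)
  ultimately show ?thesis using ord_eq_1[OF x] by auto
qed

text \<open>Let \<open>h = inv g\<close> and regard \<open>g^2\<close> as one term \<open>w\<close>.
  The sequence \<open>w h h g^n\<close> has lengths 2 and 3, since
  \<open>(w h h)(g^n) = (g h)(g h)(w g^(n-2))\<close>.\<close>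

lemma one_in_Delta_star_of_ord:
  assumes g: "g \<in> carrier G" "ord g \<ge> 3" shows "1 \<in> Delta_star G"
proof (rule Delta_starI)
  define n where "n = ord g"
  define h where "h = inv g"
  have h: "h \<in> carrier G" "ord h = n" "g \<otimes> h = \<one>" "h \<otimes> g = \<one>"
    using g by (auto simp: h_def n_def)
  have "g \<otimes> g \<otimes> (h \<otimes> h) = g \<otimes> (g \<otimes> h) \<otimes> h" using g(1) h(1) by (simp only: m_assoc m_closed)
  then have ggh: "lprod [g \<otimes> g, h, h] = \<one>" using g h by simp
  have "g \<otimes> g \<otimes> g [^] (n - 2) = g [^] (2 + (n - 2))"
    using g(1) by (simp only: nat_pow_mult[symmetric]) (simp add: numeral_2_eq_2)
  also have "2 + (n - 2) = ord g" using g(2) by (simp add: n_def)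
  finally have "g \<otimes> g \<otimes> g [^] (n - 2) = \<one>" using g(1) by simp
  then have ggg: "lprod ((g \<otimes> g) # replicate (n - 2) g) = \<one>"
    using g(1) by (simp add: lprod_replicate del: foldr_replicate)
  have A1: "add_mset (g \<otimes> g) (replicate_mset 2 h) \<in> atoms G (carrier G)"
    using g h by (intro atoms_mono[OF atom_add_replicate] product_oneI[OF ggh])
      (auto simp: n_def numeral_2_eq_2)
  have A2: "replicate_mset n g \<in> atoms G (carrier G)"
    unfolding n_def using g by (intro atom_ord_power') auto
  have A3: "add_mset h (replicate_mset 1 g) \<in> atoms G (carrier G)"
    using g h by (intro atoms_mono[OF atom_add_replicate] product_oneI[of "[h, g]"]) auto
  have A4: "add_mset (g \<otimes> g) (replicate_mset (n - 2) g) \<in> atoms G (carrier G)"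
    using g by (intro atoms_mono[OF atom_add_replicate] product_oneI[OF ggg])
      (auto simp: n_def split: if_splits)
  let ?A = "add_mset (g \<otimes> g) (replicate_mset 2 h) + replicate_mset n g"
  have "1 + 1 \<in> lengths G (carrier G) ?A" using A1 A2 by (intro lengths_add lengths_atom)
  then show "2 \<in> lengths G (carrier G) ?A" by (simp add: numeral_2_eq_2)
  have "n = Suc (Suc (n - 2))" using g by (simp add: n_def)
  then have "replicate_mset n g = add_mset g (add_mset g (replicate_mset (n - 2) g))"
    by (metis replicate_mset_Suc)
  then have "?A = add_mset h (replicate_mset 1 g) + add_mset h (replicate_mset 1 g) +
      add_mset (g \<otimes> g) (replicate_mset (n - 2) g)"
    by (simp add: numeral_2_eq_2)
  moreover have "1 + 1 + 1 \<in> lengths G (carrier G) (add_mset h (replicate_mset 1 g) +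
      add_mset h (replicate_mset 1 g) + add_mset (g \<otimes> g) (replicate_mset (n - 2) g))"
    using A3 A4 by (intro lengths_add lengths_atom)
  ultimately show "2 + 1 \<in> lengths G (carrier G) ?A" by (simp add: numeral_3_eq_3)
qed auto

text \<open>If no element has order at least 3, all nontrivial elements are involutions. For two of
  them, \<open>x\<close> and \<open>y\<close>, and \<open>z = x y\<close>, the square of the atom
  formed by \<open>x\<close>, \<open>y\<close>, \<open>z\<close> is also \<open>x^2 y^2 z^2\<close>,
  so it has lengths 2 and 3.\<close>

lemma one_in_Delta_star:
  assumes "order G \<ge> 3" shows "1 \<in> Delta_star G"
proof (cases "\<exists>g \<in> carrier G. ord g \<ge> 3")
  case True
  then show ?thesis using one_in_Delta_star_of_ord by blast
next
  case False
  have inv: "ord x = 2" if "x \<in> carrier G" "x \<noteq> \<one>" for x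
  proof -
    have "ord x \<noteq> 1" "ord x \<ge> 1" "\<not> ord x \<ge> 3"
      using ord_eq_1[OF that(1)] ord_pos[OF that(1)] False that by auto
    then show ?thesis by linarith
  qed
  have nsub: "\<not> carrier G \<subseteq> {\<one>, x}" for x
  proof
    assume "carrier G \<subseteq> {\<one>, x}"
    then have "card (carrier G) \<le> card {\<one>, x}" by (intro card_mono) auto
    also have "\<dots> \<le> 2" by (simp add: card_insert_if)
    finally show False using assms by (simp add: order_def)
  qed
  obtain x where "x \<in> carrier G" "x \<noteq> \<one>" using nsub[of \<one>] by auto
  moreover obtain y where "y \<in> carrier G" "y \<noteq> \<one>" "x \<noteq> y" using nsub[of x] by auto
  ultimately have xy: "x \<in> carrier G" "y \<in> carrier G" "x \<noteq> \<one>" "y \<noteq> \<one>" "x \<noteq> y" by auto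
  define z where "z = x \<otimes> y"
  have xx: "x \<otimes> x = \<one>" "y \<otimes> y = \<one>" using inv xy ord_2_iff by blast+
  have "z \<noteq> \<one>"
  proof
    assume "z = \<one>"
    then have "x \<otimes> y = x \<otimes> x" using xx by (simp add: z_def)
    with xy show False by simp
  qed
  moreover have z: "z \<in> carrier G" using xy by (simp add: z_def)
  ultimately have zz: "z \<otimes> z = \<one>" using inv ord_2_iff by blast
  let ?U = "{#x, y, z#}"
  have "lprod [x, y, z] = \<one>" using zz xy z by (simp add: z_def m_assoc)
  then have "product_one G ?U" by (rule product_oneI) simp
  then have "?U \<in> atoms G (set_mset ?U)"
    using xy z \<open>z \<noteq> \<one>\<close> by (intro atom_size_le_3) auto
  then have U: "?U \<in> atoms G (carrier G)" using xy z by (elim atoms_mono) auto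
  have sq: "replicate_mset 2 w \<in> atoms G (carrier G)" if "w \<in> carrier G" "w \<noteq> \<one>" for w
    using atom_ord_power'[OF that(1), of "carrier G"] inv that by simp
  have "1 + 1 + 1 \<in> lengths G (carrier G) (replicate_mset 2 x + replicate_mset 2 y + replicate_mset 2 z)"
    using sq xy z \<open>z \<noteq> \<one>\<close> by (intro lengths_add lengths_atom) auto
  moreover have "replicate_mset 2 x + replicate_mset 2 y + replicate_mset 2 z = ?U + ?U"
    by (simp add: numeral_2_eq_2)
  ultimately have 3: "2 + 1 \<in> lengths G (carrier G) (?U + ?U)" by (simp add: numeral_3_eq_3)
  have "1 + 1 \<in> lengths G (carrier G) (?U + ?U)" using U by (intro lengths_add lengths_atom)
  then have "2 \<in> lengths G (carrier G) (?U + ?U)" by (simp add: numeral_2_eq_2)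
  from Delta_starI[OF _ this 3] show ?thesis by auto
qed

text \<open>Over \<open>g\<close> and \<open>h = inv g\<close> the only atoms are
  \<open>g^n\<close>, \<open>h^n\<close> and \<open>g h\<close>, and
  \<open>(g h)^n = g^n h^n\<close> has lengths \<open>n\<close> and 2.\<close>

lemma ord_minus_2_in_Delta_star:
  assumes g: "g \<in> carrier G" "ord g \<ge> 3" shows "ord g - 2 \<in> Delta_star G"
proof -
  define n where "n = ord g"
  define h where "h = inv g"
  have n: "n \<ge> 3" using g by (simp add: n_def)
  have h: "h \<in> carrier G" "ord h = n" "g \<otimes> h = \<one>" using g by (auto simp: h_def n_def)
  have "h \<noteq> g"
  proof
    assume "h = g"
    then have "g \<otimes> g = \<one>" using h by simp
    then have "ord g = 2 \<or> g = \<one>" using ord_2_iff[OF g(1)] by blast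
    then show False using g by auto
  qed
  have gh: "{#g, h#} \<in> atoms G {g, h}"
    using atom_add_replicate[OF g(1), of h 1] g h
    by (simp add: product_one_pair inv_comm insert_commute add_mset_commute)
  \<comment> \<open>The weights 1 and \<open>n - 1\<close> give \<open>g h\<close> and
    \<open>g^n\<close> the total \<open>n\<close>, and \<open>h^n\<close> the total
    \<open>n * (n - 1) = n + n * (n - 2)\<close>. The values of \<open>e\<close> are exponents with
    respect to \<open>g\<close>.\<close>
  define f e :: "'a \<Rightarrow> int"
    where "f = (\<lambda>x. if x = g then 1 else int n - 1)" and "e = (\<lambda>x. if x = g then 1 else -1)"
  have e: "x = g [^] e x" if "x \<in> {g, h}" for x
  proof (cases "x = g")
    case True
    then show ?thesis using g(1) by (simp add: e_def)
  next
    case False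
    then have "g [^] e x = inv g" using g(1) by (simp add: e_def int_pow_neg)
    then show ?thesis using False that by (simp add: h_def)
  qed
  have f: "int n * (int n - 2) dvd (\<Sum>x\<in>#W. f x) - int n" if W: "W \<in> atoms G {g, h}" for W
  proof -
    have sub: "set_mset W \<subseteq> {g, h}" using atoms_subset[OF W] .
    consider "g \<in># W" "h \<in># W" | "set_mset W \<subseteq> {g}" | "set_mset W \<subseteq> {h}" using sub by auto
    then show ?thesis
    proof cases
      case 1
      then obtain W' where W': "W = add_mset g W'" by (meson multi_member_split)
      with 1 \<open>h \<noteq> g\<close> have "h \<in># W'" by simp
      then obtain R where "W' = add_mset h R" by (meson multi_member_split)
      with W' have R: "W = {#g, h#} + R" by simp
      have iff: "product_one G S \<longleftrightarrow> int (ord g) dvd (\<Sum>x\<in>#S. e x)" if "S \<subseteq># W" for S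
      proof (rule product_one_powers_iff[OF g(1)])
        fix x assume "x \<in># S"
        then have "x \<in> {g, h}" using that sub by (meson mset_subset_eqD subsetD)
        then show "x = g [^] e x" by (rule e)
      qed
      have "product_one G W" using W by (simp add: atoms_iff)
      then have "int (ord g) dvd (\<Sum>x\<in>#W. e x)" using iff by simp
      \<comment> \<open>Removing \<open>g h\<close> does not change the exponent sum.\<close>
      then have "int (ord g) dvd (\<Sum>x\<in>#R. e x)" using \<open>h \<noteq> g\<close> by (simp add: R e_def)
      then have "product_one G R"
        using iff[of R] R by simp
      moreover have "product_one G {#g, h#}" using gh by (simp add: atoms_iff)
      ultimately have "R = {#}" using atom_split[OF W R] by simp
      then show ?thesis using \<open>h \<noteq> g\<close> by (simp add: R f_def)
    next
      case 2
      then have "W = replicate_mset n g" using atom_single_support[OF W _ g(1)] by (simp add: n_def)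
      then show ?thesis by (simp add: f_def)
    next
      case 3
      then have "W = replicate_mset n h" using atom_single_support[OF W _ h(1)] h(2) by simp
      then show ?thesis using \<open>h \<noteq> g\<close> by (simp add: f_def algebra_simps)
    qed
  qed
  have "n - 2 \<in> Delta_star G"
  proof (rule Delta_starI)
    show "{g, h} \<subseteq> carrier G" using g h by simp
    show "n - 2 \<ge> 1" using n by simp
    have "replicate_mset n g \<in> atoms G {g, h}" "replicate_mset n h \<in> atoms G {g, h}"
      using atom_ord_power'[OF g(1), of "{g, h}"] atom_ord_power'[OF h(1), of "{g, h}"] h(2)
      by (simp_all add: n_def)
    then have "1 + 1 \<in> lengths G {g, h} (replicate_mset n g + replicate_mset n h)"
      by (intro lengths_add lengths_atom)
    moreover have "replicate_mset n g + replicate_mset n h = repeat_mset n {#g, h#}"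
      by (rule multiset_eqI) simp
    ultimately show "2 \<in> lengths G {g, h} (repeat_mset n {#g, h#})" by (simp only: one_add_one)
    show "2 + (n - 2) \<in> lengths G {g, h} (repeat_mset n {#g, h#})"
    proof -
      have "2 + (n - 2) = n" using n by simp
      then show ?thesis using lengths_atom_power[OF gh, of n] by (simp only:)
    qed
    show "int (n - 2) dvd int i - int j"
      if "i \<in> lengths G {g, h} B" "j \<in> lengths G {g, h} B" for B i j
    proof -
      have eq: "int (n - 2) = int n - 2" "int n \<noteq> 0" using n by auto
      show ?thesis unfolding eq(1) by (rule lengths_functional[OF f eq(2) that])
    qed
  qed
  then show ?thesis by (simp add: n_def)
qed

lemma Delta_star_le: "d \<in> Delta_star G \<Longrightarrow> d + 2 \<le> davenport G (carrier G)"
proof (elim Delta_starE)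
  fix G0 assume *: "G0 \<subseteq> carrier G" "Delta G G0 \<noteq> {}" "min_distance G G0 = d"
  obtain U where "U \<in> atoms G G0" using ex_cross_number_neq_1[OF *(2)] by blast
  then show ?thesis
    using min_distance_le_davenport[OF *(1,2)] davenport_mono[OF *(1), of U] *(3) by simp
qed

lemma finite_Delta_star: "finite (Delta_star G)"
proof (rule finite_subset)
  show "Delta_star G \<subseteq> {..davenport G (carrier G)}" using Delta_star_le by fastforce
qed simp

lemma cyclic_groupI:
  assumes "g \<in> carrier G" "order G \<le> ord g" shows "cyclic_group G"
proof -
  have "generate G {g} \<subseteq> carrier G" using generate_in_carrier assms(1) by blast
  then have "generate G {g} = carrier G"
    using generate_pow_card[OF assms(1)] assms(2) finite_carrier
    by (intro card_seteq) (auto simp: order_def)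
  then show ?thesis using generate_pow[OF assms(1)] assms(1) unfolding cyclic_group by (auto simp: full_SetCompr_eq)
qed

lemma cyclic_groupE:
  assumes "cyclic_group G" obtains g where "g \<in> carrier G" "ord g = order G"
proof -
  obtain g where g: "g \<in> carrier G" "carrier G = range (\<lambda>n::int. g [^] n)"
    using assms unfolding cyclic_group by blast
  then have "generate G {g} = carrier G" using generate_pow[OF g(1)] by auto
  then show thesis using that[OF g(1)] generate_pow_card[OF g(1)] by (simp add: order_def)
qed

end

section \<open>Extremal cases\<close>

context finite_group
begin

section \<open>Equality in the bound by the Davenport constant\<close>

lemma subgroup_lprod_closed: "subgroup H G \<Longrightarrow> set xs \<subseteq> H \<Longrightarrow> lprod xs \<in> H"
  by (induction xs) (auto simp: subgroup.one_closed subgroup.m_closed)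

text \<open>The other terms have a product in \<open>H\<close> with inverse \<open>h\<close>. Its
  use: a product-one sequence cannot have exactly one term outside a subgroup.\<close>

lemma product_one_mem_subgroup:
  assumes H: "subgroup H G" and h: "h \<in> carrier G" and S: "set_mset S \<subseteq> H"
    and one: "product_one G (add_mset h S)"
  shows "h \<in> H"
proof -
  have S': "set_mset S \<subseteq> carrier G" using S subgroup.subset[OF H] by blast
  obtain xs where xs: "mset xs = S" "h \<otimes> lprod xs = \<one>"
    using product_one_add_msetE[OF one h S'] .
  have "set xs \<subseteq> H" using xs(1) S by auto
  then have p: "lprod xs \<in> H" using subgroup_lprod_closed[OF H] by blast
  then have "lprod xs \<in> carrier G" using subgroup.subset[OF H] by blast
  then have "h = inv (lprod xs)" using xs(2) h by (metis inv_equality)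
  then show ?thesis using subgroup.m_inv_closed[OF H p] by simp
qed

text \<open>If \<open>h \<notin> \<langle>g\<rangle>\<close>, then \<open>h\<close>, \<open>h\<^bsup>-1\<^esup>g\<close> and \<open>ord g - 1\<close> copies of \<open>g\<close> form an atom.\<close>

lemma ord_less_davenport:
  assumes g: "g \<in> carrier G" and not_cyclic: "\<not> cyclic_group G"
  shows "ord g < davenport G (carrier G)"
proof -
  define n where "n = ord g"
  define K where "K = generate G {g}"
  have K: "subgroup K G" unfolding K_def using g by (intro generate_is_subgroup) auto
  have gK: "g \<in> K" unfolding K_def by (simp add: generate.incl)
  have n1: "n \<ge> 1" using ord_pos[OF g] by (simp add: n_def)
  have "card K = n" using generate_pow_card[OF g] by (simp add: K_def n_def)
  moreover have "\<not> order G \<le> n" using cyclic_groupI[OF g] not_cyclic by (auto simp: n_def)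
  ultimately have "\<not> carrier G \<subseteq> K"
    using subgroup.subset[OF K] by (auto simp: order_def)
  then obtain h where h: "h \<in> carrier G" "h \<notin> K" by blast
  \<comment> \<open>This choice makes \<open>h f\<close> equal to \<open>g\<close>, so the word
    \<open>h f g^(n-1)\<close> has the value \<open>g^n\<close> but length
    \<open>n + 1\<close>.\<close>
  define f where "f = inv h \<otimes> g"
  have f: "f \<in> carrier G" using h g by (simp add: f_def)
  have fK: "f \<notin> K"
  proof
    assume "f \<in> K"
    then have "g \<otimes> inv f \<in> K" using K gK by (simp add: subgroup.m_closed subgroup.m_inv_closed)
    moreover have "g \<otimes> inv f = h" using g h by (simp add: f_def inv_mult_group flip: m_assoc)
    ultimately show False using h by simp
  qed
  define R where "R = replicate_mset (n - 1) g"
  define U where "U = add_mset h (add_mset f R)"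
  have "lprod (h # f # replicate (n - 1) g) = h \<otimes> (f \<otimes> g [^] (n - 1))"
    using g by (simp add: lprod_replicate del: foldr_replicate)
  also have "\<dots> = g \<otimes> g [^] (n - 1)" using g h by (simp add: f_def flip: m_assoc)
  also have "\<dots> = g [^] Suc (n - 1)" by (rule nat_pow_Suc2[OF g, symmetric])
  also have "Suc (n - 1) = ord g" using n1 by (simp add: n_def)
  also have "g [^] ord g = \<one>" using g by simp
  finally have U1: "product_one G U" by (rule product_oneI) (simp add: U_def R_def)
  have R: "B = {#}" if "B \<subseteq># R" "product_one G B" for B
  proof -
    obtain j where j: "B = replicate_mset j g" "j \<le> n - 1"
      using \<open>B \<subseteq># R\<close> unfolding R_def by (metis msubseteq_replicate_msetE)
    then have "ord g dvd j" using that(2) g by (simp add: product_one_replicate_mset)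
    with j n1 have "j = 0" by (auto dest: dvd_imp_le simp: n_def)
    with j show ?thesis by simp
  qed
  have RK: "set_mset R \<subseteq> K" using gK by (auto simp: R_def)
  \<comment> \<open>By symmetry only the part containing \<open>h\<close> is examined. If
    \<open>f\<close> is in it too, the other part has fewer than \<open>n\<close> terms, all equal
    to \<open>g\<close>; otherwise \<open>h\<close> is the only term of its part outside
    \<open>K\<close>.\<close>
  have main: "C = {#}"
    if BC: "U = B + C" "product_one G B" "product_one G C" "h \<in># B" for B C
  proof -
    obtain B' where B': "B = add_mset h B'" using BC(4) by (meson multi_member_split)
    have eq: "add_mset f R = B' + C" using BC(1) unfolding U_def B' by simp
    have "f \<in># B' + C" unfolding eq[symmetric] by simp
    then consider "f \<in># B'" | "f \<in># C" by auto
    then show ?thesis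
    proof cases
      case 1
      then obtain B'' where "B' = add_mset f B''" by (meson multi_member_split)
      then have "R = B'' + C" using eq by simp
      then have "C \<subseteq># R" by simp
      then show ?thesis using R BC(3) by blast
    next
      case 2
      then obtain C' where "C = add_mset f C'" by (meson multi_member_split)
      then have "R = B' + C'" using eq by simp
      then have "set_mset B' \<subseteq> K" using RK by auto
      then have "h \<in> K" using product_one_mem_subgroup[OF K h(1)] BC(2) B' by blast
      then show ?thesis using h by simp
    qed
  qed
  have "B = {#} \<or> C = {#}" if BC: "U = B + C" "product_one G B" "product_one G C" for B C
  proof -
    have "h \<in># B + C" unfolding BC(1)[symmetric] U_def by simp
    then consider "h \<in># B" | "h \<in># C" by auto
    then show ?thesis
    proof cases
      case 1
      then show ?thesis using main[OF BC] by simp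
    next
      case 2
      have "U = C + B" using BC(1) by (simp add: add.commute)
      then show ?thesis using main[OF _ BC(3,2)] 2 by simp
    qed
  qed
  moreover have "set_mset U \<subseteq> carrier G"
    using h f RK subgroup.subset[OF K] by (auto simp: U_def)
  ultimately have "U \<in> atoms G (carrier G)" using U1 by (simp add: atoms_iff U_def)
  from size_atom_le_davenport[OF this] show ?thesis
    using n1 by (simp add: U_def R_def flip: n_def)
qed

text \<open>Outside the cyclic case \<open>ord_less_davenport\<close> excludes the long power of one
  element, so an atom of involutions of maximal length remains. It is also an atom over the subgroup
  generated by its terms.\<close>

lemma involution_subgroup_of_max_Delta_star:
  assumes d: "d \<in> Delta_star G" "d + 2 = davenport G (carrier G)" and not_cyclic: "\<not> cyclic_group G"
  shows "\<exists>G1. subgroup G1 G \<and> davenport G G1 = davenport G (carrier G) \<and>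
           (\<exists>S \<subseteq> G1. (\<forall>x \<in> S. ord x = 2) \<and> generate G S = G1)"
proof -
  obtain G0 where G0: "G0 \<subseteq> carrier G" "Delta G G0 \<noteq> {}" "min_distance G G0 = d"
    using Delta_starE[OF d(1)] .
  from G0(1,2) show ?thesis
  proof (cases rule: min_distance_cases)
    case (large_order g)
    then have "ord g < davenport G (carrier G)" using ord_less_davenport not_cyclic G0(1) by blast
    with large_order d(2) G0(3) show ?thesis by simp
  next
    case (large_atom U)
    have "size W \<le> min_distance G G0 + 2" if "W \<in> atoms G G0" for W
      using size_atom_le_davenport[OF atoms_mono[OF that]] atoms_subset[OF that] G0 d(2) by auto
    with large_atom have ord2: "\<forall>x \<in># U. ord x = 2" by blast
    let ?G1 = "generate G (set_mset U)"
    have U: "set_mset U \<subseteq> carrier G" using atoms_subset[OF large_atom(1)] G0(1) by simp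
    then have G1: "subgroup ?G1 G" by (rule generate_is_subgroup)
    have sub: "set_mset U \<subseteq> ?G1" by (auto intro: generate.incl)
    have UG1: "U \<in> atoms G ?G1" using atoms_mono[OF large_atom(1) sub] .
    have "davenport G (carrier G) \<le> size U" using large_atom(2) G0(3) d(2) by simp
    also have "\<dots> \<le> davenport G ?G1"
      using size_atom_le_davenport[OF UG1] subgroup.subset[OF G1] by blast
    finally have "davenport G ?G1 = davenport G (carrier G)"
      using davenport_mono[OF subgroup.subset[OF G1] subset_refl UG1] by simp
    with G1 sub ord2 show ?thesis by blast
  qed
qed

section \<open>Parity in atoms of involutions\<close>

lemma product_one_repeat_2:
  assumes "\<forall>x \<in># T. ord x = 2" "set_mset T \<subseteq> carrier G"
  shows "product_one G (repeat_mset 2 T)"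
  using assms
proof (induction T)
  case (add x T)
  then have x: "x \<in> carrier G" "x \<otimes> x = \<one>" using ord_2_iff by auto
  have "product_one G {#x, x#}" using x by (simp add: product_one_pair)
  moreover have "product_one G (repeat_mset 2 T)" using add by simp
  moreover have "repeat_mset 2 (add_mset x T) = {#x, x#} + repeat_mset 2 T"
    by (rule multiset_eqI) simp
  ultimately show ?case
    using x add.prems set_mset_repeat_mset_subset[of 2 T]
    by (metis (no_types, lifting) empty_subsetI insert_subset product_one_add set_mset_add_mset_insert
        set_mset_empty subset_trans)
qed simp

text \<open>Were all multiplicities even, \<open>U\<close> would be a square \<open>T^2\<close>. A
  pair \<open>x x\<close> could be removed from it, and the rest, again a square of involutions,
  would be product-one.\<close>

lemma involution_atom_odd_count:
  assumes U: "U \<in> atoms G G0" and G0: "G0 \<subseteq> carrier G" and ord2: "\<forall>x \<in># U. ord x = 2"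
    and size: "size U > 2"
  shows "\<exists>z. odd (count U z)"
proof (rule ccontr)
  assume "\<not> ?thesis"
  then have "even (count U z)" for z by simp
  from even_counts_imp_repeat_mset[OF this] obtain T where T: "U = repeat_mset 2 T" ..
  then have "T \<noteq> {#}" using size by auto
  then obtain x T' where T': "T = add_mset x T'" by (meson multiset_cases)
  have U2: "U = {#x, x#} + repeat_mset 2 T'" unfolding T T' by (rule multiset_eqI) simp
  have mem: "z \<in># T \<Longrightarrow> z \<in># U" for z
    unfolding T by (simp flip: count_greater_zero_iff)
  have T2: "\<forall>z \<in># T. ord z = 2" "set_mset T \<subseteq> carrier G"
    using mem ord2 atoms_subset[OF U] G0 by blast+
  have "product_one G (repeat_mset 2 T')"
    by (rule product_one_repeat_2) (use T2 T' in simp_all)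
  moreover have "x \<in> carrier G" "ord x = 2" using T2 T' by simp_all
  then have "product_one G {#x, x#}" using ord_2_iff[of x] by (simp add: product_one_pair)
  ultimately have "repeat_mset 2 T' = {#}" using atom_split[OF U U2] by simp
  with U2 have "size U = 2" by (simp only: add_0_right size_add_mset size_empty)
  with size show False by simp
qed

text \<open>Two involutions with product one are equal, so such an atom is a pair
  \<open>x x\<close>.\<close>

lemma small_involution_atom:
  assumes W: "W \<in> atoms G G0" "\<forall>x \<in># W. ord x = 2" and G0: "G0 \<subseteq> carrier G" and size: "size W \<le> 2"
  shows "even (count W z)"
proof -
  have car: "x \<in> carrier G" if "x \<in># W" for x using that atoms_subset[OF W(1)] G0 by auto
  have "W \<noteq> {#}" "product_one G W" using W(1) by (auto simp: atoms_iff)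
  then obtain x W' where x: "W = add_mset x W'" by (meson multiset_cases)
  have xx: "x \<in> carrier G" "x \<noteq> \<one>" "x \<otimes> x = \<one>" using car[of x] W(2) ord_2_iff[of x] x by auto
  have "W' \<noteq> {#}" using \<open>product_one G W\<close> x xx by (auto simp: product_one_single)
  moreover have "size W' \<le> 1" using size x by simp
  ultimately have "size W' = 1" by (simp add: le_less_Suc_eq nonempty_has_size)
  then obtain y where y: "W' = {#y#}" using size_1_singleton_mset by blast
  have "y \<in> carrier G" using car[of y] x y by simp
  moreover have "x \<otimes> y = \<one>"
    using \<open>product_one G W\<close> \<open>y \<in> carrier G\<close> xx by (simp add: x y product_one_pair)
  ultimately have "y = x" using xx by (metis l_cancel)
  then show ?thesis by (simp add: x y)
qed

text \<open>The minimal distance \<open>d\<close> divides \<open>|W| - 2\<close> for every atom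
  \<open>W\<close> of involutions, so an atom shorter than \<open>d + 2\<close> is a pair
  \<open>x x\<close>. Conversely, an odd multiplicity certifies length at least
  \<open>d + 2\<close>.\<close>

lemma even_count_of_short_sequence:
  assumes G0: "G0 \<subseteq> carrier G" and S: "product_one G S" "set_mset S \<subseteq> G0"
    and ord2: "\<forall>x \<in># S. ord x = 2" and size: "size S < min_distance G G0 + 2"
  shows "even (count S z)"
proof -
  \<comment> \<open>Factoring over the support of \<open>S\<close> ensures that all factors consist
    of involutions.\<close>
  obtain F where F: "set_mset F \<subseteq> atoms G (set_mset S)" "\<Sum>\<^sub># F = S"
    using ex_factorization[OF S(1) subset_refl] by blast
  have "even (count W z)" if W: "W \<in># F" for W
  proof -
    have WS: "W \<in> atoms G (set_mset S)" using F(1) W by blast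
    have sub: "set_mset W \<subseteq> set_mset S" using atoms_subset[OF WS] .
    have W0: "W \<in> atoms G G0" using atoms_mono[OF WS] sub S(2) by blast
    have W2: "\<forall>x \<in># W. ord x = 2" using ord2 sub by blast
    obtain F' where "F = add_mset W F'" using W by (meson multi_member_split)
    then have "size W \<le> size S" using F(2) by auto
    have "size W \<le> 2"
    proof (rule ccontr)
      assume "\<not> size W \<le> 2"
      moreover have "int (min_distance G G0) dvd int (size W) - 2"
        by (rule involutive_atom_distance[OF G0 W0 W2])
      ultimately have "int (min_distance G G0) \<le> int (size W) - 2" by (intro zdvd_imp_le) auto
      with size \<open>size W \<le> size S\<close> show False by linarith
    qed
    then show ?thesis using small_involution_atom[OF W0 W2 G0] by blast
  qed
  then have "even (count (\<Sum>\<^sub># F) z)" by (induction F) auto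
  with F(2) show ?thesis by simp
qed

text \<open>Deleting two neighbouring equal involutions does not change the product of the word, so
  the pair and the rest would split the atom.\<close>

lemma atom_no_adjacent_involutions:
  assumes U: "mset (as @ z # z # cs) \<in> atoms G G0" "lprod (as @ z # z # cs) = \<one>" and G0: "G0 \<subseteq> carrier G"
    and z: "z \<otimes> z = \<one>"
  shows "as = [] \<and> cs = []"
proof -
  have car: "set as \<subseteq> carrier G" "z \<in> carrier G" "set cs \<subseteq> carrier G"
    using atoms_subset[OF U(1)] G0 by auto
  have "lprod (z # z # cs) = (z \<otimes> z) \<otimes> lprod cs" using car by (simp add: m_assoc)
  then have "lprod (as @ cs) = \<one>" using U(2) car z by simp
  then have "product_one G (mset (as @ cs))" by (rule product_oneI) simp
  moreover have "product_one G {#z, z#}" using car z by (simp add: product_one_pair)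
  moreover have split: "mset (as @ z # z # cs) = {#z, z#} + mset (as @ cs)" by simp
  ultimately have "mset (as @ cs) = {#}" using atom_split[OF U(1) split] by simp
  then show ?thesis by simp
qed

text \<open>The prefix products of an atom of length \<open>|G|\<close> form a Hamiltonian cycle in the Cayley graph.
  A chord at the vertex \<open>1\<close> would split it into two shorter product-one sequences, so at most two
  generators occur, and they alternate.\<close>

lemma dihedral_group_of_long_involution_atom:
  assumes G0: "G0 \<subseteq> carrier G" and U: "U \<in> atoms G G0" "\<forall>x \<in># U. ord x = 2"
    and size: "size U = order G" and d: "min_distance G G0 + 2 = order G" and ge3: "order G \<ge> 3"
  shows "\<exists>n. odd n \<and> n \<ge> 3 \<and> dihedral_group G n"
proof -
  obtain xs where xs: "mset xs = U" "lprod xs = \<one>"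
    using U(1) unfolding atoms_iff product_one_def by blast
  define l where "l = length xs"
  have l: "l = order G" using size xs(1) by (auto simp: l_def)
  have sub: "set xs \<subseteq> G0" using atoms_subset[OF U(1)] xs(1) by auto
  have car: "set xs \<subseteq> carrier G" using sub G0 by blast
  have ord2: "\<forall>x \<in> set xs. ord x = 2" using U(2) xs(1) by auto
  have sq: "x \<in> carrier G" "x \<noteq> \<one>" "x \<otimes> x = \<one>" if "x \<in> set xs" for x
    using that car ord2 ord_2_iff[of x] by auto
  have U': "mset xs \<in> atoms G G0" using U(1) xs(1) by simp
  have odd_count: "\<exists>z. odd (count U z)"
    using involution_atom_odd_count[OF U(1) G0 U(2)] size ge3 by simp
  have inj: "inj_on (\<lambda>i. lprod (take i xs)) {..<l}"
    unfolding l_def by (rule atom_prefix_products_inj[OF U' G0 xs(2)])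
  have "(\<lambda>i. lprod (take i xs)) ` {..<l} \<subseteq> carrier G"
    using car by (auto intro!: lprod_closed dest!: in_set_takeD)
  moreover have "card ((\<lambda>i. lprod (take i xs)) ` {..<l}) = card (carrier G)"
    using card_image[OF inj] l by (simp add: order_def)
  ultimately have onto: "(\<lambda>i. lprod (take i xs)) ` {..<l} = carrier G"
    using finite_carrier card_subset_eq by blast
  \<comment> \<open>The first and the last letter label the two edges of the cycle at the vertex
    1.\<close>
  define x y where "x = xs ! 0" and "y = xs ! (l - 1)"
  have l3: "l \<ge> 3" using l ge3 by simp
  have xy: "x \<in> set xs" "y \<in> set xs"
    unfolding x_def y_def using l3 unfolding l_def by - (rule nth_mem; linarith)+
  have two: "g = x \<or> g = y" if g: "g \<in> set xs" for g
  proof -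
    \<comment> \<open>The prefix products exhaust the group, so \<open>g\<close> itself is one of
      them. The chord from 1 to \<open>g\<close> closes both arcs of the cycle into product-one
      sequences.\<close>
    have "g \<in> (\<lambda>i. lprod (take i xs)) ` {..<l}" unfolding onto by (rule sq(1)[OF g])
    then obtain j where j: "j < l" "lprod (take j xs) = g" by (elim imageE) simp
    define as cs where "as = take j xs" and "cs = drop j xs"
    have ac: "xs = as @ cs" by (simp add: as_def cs_def)
    have cc: "set as \<subseteq> carrier G" "set cs \<subseteq> carrier G" using car unfolding ac by auto
    have as: "lprod as = g" using j by (simp add: as_def)
    have cs: "g \<otimes> lprod cs = \<one>" using xs(2) cc as unfolding ac by simp
    have "j \<noteq> 0"
    proof
      assume "j = 0"
      then have "g = \<one>" using j(2) by simp
      then show False using sq(2)[OF g] by simp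
    qed
    have P1: "product_one G (add_mset g (mset as))"
      by (rule product_oneI[of "as @ [g]"]) (use cc as sq[OF g] in auto)
    have P2: "product_one G (add_mset g (mset cs))"
      by (rule product_oneI[of "g # cs"]) (use cs in auto)
    have len: "length as = j" "length cs = l - j" using j by (auto simp: as_def cs_def l_def)
    have "j = 1 \<or> j = l - 1"
    proof (rule ccontr)
      assume "\<not> ?thesis"
      with \<open>j \<noteq> 0\<close> j(1) have "2 \<le> j" "j + 1 < l" by auto
      \<comment> \<open>The closed arcs have lengths \<open>j + 1\<close> and
        \<open>l - j + 1\<close>, both below \<open>l = d + 2\<close>.\<close>
      then have sz: "size (add_mset g (mset as)) < min_distance G G0 + 2"
        "size (add_mset g (mset cs)) < min_distance G G0 + 2"
        unfolding size_add_mset size_mset len d l[symmetric] by linarith+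
      have "even (count U z)" for z
      proof -
        have "even (count (add_mset g (mset as)) z)"
          using g ord2 sub ac by (intro even_count_of_short_sequence[OF G0 P1 _ _ sz(1)]) auto
        moreover have "even (count (add_mset g (mset cs)) z)"
          using g ord2 sub ac by (intro even_count_of_short_sequence[OF G0 P2 _ _ sz(2)]) auto
        \<comment> \<open>The chord is counted twice and does not affect parities.\<close>
        moreover have "count (add_mset g (mset as)) z + count (add_mset g (mset cs)) z =
            count U z + 2 * count {#g#} z"
          unfolding xs(1)[symmetric] ac by simp
        ultimately have "even (count U z + 2 * count {#g#} z)" by (metis even_add)
        then show ?thesis by simp
      qed
      with odd_count show False by blast
    qed
    then show ?thesis
    proof
      assume "j = 1"
      then have "as = [x]" using l3 by (cases xs) (auto simp: as_def x_def l_def)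
      then show ?thesis using as xy sq by simp
    next
      assume "j = l - 1"
      then have "cs = [y]" using l3 Cons_nth_drop_Suc[of j xs] by (simp add: cs_def y_def l_def)
      then have "g \<otimes> y = g \<otimes> g" using cs xy sq g by simp
      then have "y = g" using l_cancel sq(1)[OF g] sq(1)[OF xy(2)] by blast
      then show ?thesis by simp
    qed
  qed
  \<comment> \<open>With a single letter, \<open>x^l\<close> being product-one makes
    \<open>l\<close> even, and no multiplicity would be odd.\<close>
  have "x \<noteq> y"
  proof
    assume "x = y"
    then have "xs = replicate l x" using two unfolding l_def by (intro replicate_eqI) auto
    then have Ur: "U = replicate_mset l x" using xs(1) by (metis mset_replicate)
    then have "ord x dvd l" using U(1) product_one_replicate_mset[OF sq(1)[OF xy(1)]] by (simp add: atoms_iff)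
    then have "even l" using ord2 xy(1) by simp
    then have "even (count U z)" for z by (simp add: Ur)
    with odd_count show False by blast
  qed
  have adj: "xs ! i \<noteq> xs ! Suc i" if i: "Suc i < l" for i
  proof
    assume eq: "xs ! i = xs ! Suc i"
    have "xs = take i xs @ xs ! i # xs ! Suc i # drop (Suc (Suc i)) xs"
      using i unfolding l_def by (simp add: Cons_nth_drop_Suc)
    then obtain as cs z where split: "xs = as @ z # z # cs" using eq by metis
    have "as = [] \<and> cs = []"
      using U' xs(2) sq(3)[of z] split by (intro atom_no_adjacent_involutions[OF _ _ G0]) auto
    then have "l = 2" by (simp add: l_def split)
    with l3 show False by simp
  qed
  have alt: "xs ! i = (if even i then x else y)" if "i < l" for i
    using that
  proof (induction i)
    case 0
    then show ?case by (simp add: x_def)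
  next
    case (Suc i)
    then have "xs ! Suc i \<in> set xs" by (simp add: l_def)
    then have "xs ! Suc i = x \<or> xs ! Suc i = y" by (rule two)
    moreover have "xs ! i = (if even i then x else y)" using Suc by simp
    moreover have "xs ! i \<noteq> xs ! Suc i" using adj Suc by blast
    ultimately show ?case by (auto split: if_splits)
  qed
  \<comment> \<open>The last letter is \<open>y\<close>, so the alternating word starting with
    \<open>x\<close> has even length.\<close>
  have "y = (if even (l - 1) then x else y)" using alt[of "l - 1"] l3 unfolding y_def[symmetric] by simp
  then have "odd (l - 1)" using \<open>x \<noteq> y\<close> by metis
  then obtain k where "l - 1 = 2 * k + 1" by (rule oddE)
  then have "l = 2 * (k + 1)" using l3 by arith
  then obtain n where n: "l = 2 * n" ..
  define r where "r = x \<otimes> y"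
  have xyc: "x \<in> carrier G" "y \<in> carrier G" "x \<otimes> x = \<one>" "y \<otimes> y = \<one>" using xy sq by auto
  have r: "r \<in> carrier G" using xyc by (simp add: r_def)
  have pre: "lprod (take (2 * i) xs) = r [^] i \<and> mset (take (2 * i) xs) = repeat_mset i {#x, y#}"
    if "i \<le> n" for i
    using that
  proof (induction i)
    case (Suc i)
    then have i: "2 * i < l" "Suc (2 * i) < l" using n by auto
    have t: "take (2 * Suc i) xs = take (2 * i) xs @ [x, y]"
      using i alt[of "2 * i"] alt[of "Suc (2 * i)"] by (simp add: take_Suc_conv_app_nth l_def)
    have c: "set (take (2 * i) xs) \<subseteq> carrier G" using car set_take_subset by (metis subset_trans)
    have IH: "lprod (take (2 * i) xs) = r [^] i" "mset (take (2 * i) xs) = repeat_mset i {#x, y#}"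
      using Suc by auto
    have "lprod (take (2 * Suc i) xs) = r [^] i \<otimes> r"
      unfolding t using c IH(1) xyc by (simp add: r_def)
    moreover have "mset (take (2 * Suc i) xs) = repeat_mset i {#x, y#} + {#x, y#}"
      unfolding t using IH(2) by simp
    ultimately show ?case by (simp add: add.commute)
  qed simp
  have all: "take (2 * n) xs = xs" by (simp add: n[symmetric] l_def)
  have rn: "r [^] n = \<one>" using pre[of n] all xs(2) by simp
  have Un: "U = repeat_mset n {#x, y#}" using pre[of n] all xs(1) by simp
  \<comment> \<open>A smaller order would bring the prefix product back to 1 after
    \<open>2 * ord r < l\<close> letters.\<close>
  have "ord r = n"
  proof (rule ccontr)
    assume "ord r \<noteq> n"
    moreover have "ord r dvd n" using rn pow_eq_id[OF r] by blast
    moreover have "n > 0" using n l3 by simp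
    ultimately have lt: "ord r < n" by (auto dest: dvd_imp_le)
    then have "lprod (take (2 * ord r) xs) = \<one>" using pre[of "ord r"] r by simp
    then have "lprod (take (2 * ord r) xs) = lprod (take 0 xs)" by simp
    moreover have "2 * ord r \<in> {..<l}" "0 \<in> {..<l}" using lt n by auto
    ultimately have "2 * ord r = 0" by (rule inj_onD[OF inj])
    then show False using ord_pos[OF r] by simp
  qed
  \<comment> \<open>Both letters occur exactly \<open>n\<close> times, and some multiplicity is
    odd.\<close>
  have "odd n"
  proof
    assume "even n"
    then have "even (count U z)" for z by (simp add: Un)
    with odd_count show False by blast
  qed
  moreover have "n \<ge> 3"
  proof -
    have "n \<noteq> 2" using \<open>odd n\<close> by auto
    then show ?thesis using n l3 by linarith
  qed
  moreover have "dihedral_group G n"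
  proof -
    have iy: "inv y = y" "inv x = x" using xyc by (auto intro: inv_equality)
    have "y \<otimes> r \<otimes> inv y = y \<otimes> x \<otimes> (y \<otimes> y)" unfolding iy r_def using xyc(1,2) by (simp only: m_assoc m_closed)
    also have "\<dots> = y \<otimes> x" using xyc by simp
    also have "\<dots> = inv r" unfolding r_def using xyc iy by (simp add: inv_mult_group)
    finally have conj: "y \<otimes> r \<otimes> inv y = inv r" .
    have K: "subgroup (generate G {r, y}) G" using r xyc by (intro generate_is_subgroup) auto
    have ry: "r \<in> generate G {r, y}" "y \<in> generate G {r, y}" by (auto intro: generate.incl)
    \<comment> \<open>The prefix products of a word in \<open>x\<close> and \<open>y\<close> cover
      the group, so it is enough that both letters lie in the generated subgroup.\<close>
    have "x = r \<otimes> y" using xyc by (simp add: r_def m_assoc)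
    then have "x \<in> generate G {r, y}" using subgroup.m_closed[OF K ry] by simp
    then have "set xs \<subseteq> generate G {r, y}" using two ry by auto
    then have "set (take i xs) \<subseteq> generate G {r, y}" for i using set_take_subset by (metis subset_trans)
    then have "carrier G \<subseteq> generate G {r, y}"
      unfolding onto[symmetric] using subgroup_lprod_closed[OF K] by blast
    then have gen: "generate G {r, y} = carrier G" using subgroup.subset[OF K] by blast
    have "ord y = 2" using ord2 xy by blast
    then have "\<exists>a \<in> carrier G. \<exists>b \<in> carrier G. generate G {a, b} = carrier G \<and> ord a = n \<and> ord b = 2 \<and>
        b \<otimes> a \<otimes> inv b = inv a"
      using r xyc(2) gen \<open>ord r = n\<close> conj by (intro bexI[where x = r] bexI[where x = y] conjI)
    then show ?thesis unfolding dihedral_group_def using l n l3 is_group by auto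
  qed
  ultimately show ?thesis by blast
qed

lemma cyclic_or_dihedral_of_max_Delta_star:
  assumes d: "d \<in> Delta_star G" "d + 2 = order G" and ge3: "order G \<ge> 3"
  shows "cyclic_group G \<or> (\<exists>n. odd n \<and> n \<ge> 3 \<and> dihedral_group G n)"
proof -
  obtain G0 where G0: "G0 \<subseteq> carrier G" "Delta G G0 \<noteq> {}" "min_distance G G0 = d"
    using Delta_starE[OF d(1)] .
  from G0(1,2) show ?thesis
  proof (cases rule: min_distance_cases)
    case (large_order g)
    then have "cyclic_group G" using G0 d(2) by (intro cyclic_groupI[of g]) auto
    then show ?thesis ..
  next
    case (large_atom U)
    have "size W \<le> min_distance G G0 + 2" if "W \<in> atoms G G0" for W
      using size_atom_le_order[OF that G0(1)] G0(3) d(2) by simp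
    with large_atom have ord2: "\<forall>x \<in># U. ord x = 2" by blast
    have "size U = order G"
      using large_atom(2) size_atom_le_order[OF large_atom(1) G0(1)] G0(3) d(2) by simp
    then show ?thesis
      using dihedral_group_of_long_involution_atom[OF G0(1) large_atom(1) ord2] G0(3) d(2) ge3 by simp
  qed
qed

end

section \<open>Words in dihedral groups\<close>

lemma mset_two_support:
  assumes "set_mset S \<subseteq> {x, y}" "x \<noteq> y"
  shows "S = replicate_mset (count S x) x + replicate_mset (count S y) y"
proof (rule multiset_eqI)
  fix z
  show "count S z = count (replicate_mset (count S x) x + replicate_mset (count S y) y) z"
  proof (cases "z \<in> {x, y}")
    case True
    with assms(2) show ?thesis by auto
  next
    case False
    then have "z \<notin># S" using assms(1) by blast
    with False show ?thesis by (simp add: not_in_iff)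
  qed
qed

context finite_group
begin

section \<open>A normal form for words in \<open>r\<close> and \<open>b\<close>\<close>

lemma inverting_involution_nat_pow:
  assumes "r \<in> carrier G" "b \<in> carrier G" "b \<otimes> r = inv r \<otimes> b"
  shows "b \<otimes> r [^] (m::nat) = inv r [^] m \<otimes> b"
proof (induction m)
  case (Suc m)
  have "b \<otimes> r [^] Suc m = (b \<otimes> r [^] m) \<otimes> r" using assms(1,2) by (simp add: m_assoc)
  also have "\<dots> = inv r [^] m \<otimes> (b \<otimes> r)" unfolding Suc using assms(1,2) by (simp add: m_assoc)
  also have "\<dots> = inv r [^] Suc m \<otimes> b" unfolding assms(3) using assms(1,2) by (simp add: m_assoc)
  finally show ?case .
qed (use assms in simp)

lemma inverting_involution_int_pow:
  assumes r: "r \<in> carrier G" and b: "b \<in> carrier G" and br: "b \<otimes> r = inv r \<otimes> b"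
  shows "b \<otimes> r [^] (k::int) = r [^] (- k) \<otimes> b"
proof (cases k)
  case (nonneg m)
  then show ?thesis using inverting_involution_nat_pow[OF assms, of m] r
    by (simp add: int_pow_int int_pow_neg nat_pow_inv)
next
  case (neg m)
  \<comment> \<open>Negative powers are reduced to the natural case for \<open>inv r\<close>, which
    \<open>b\<close> inverts as well.\<close>
  have "r \<otimes> b \<otimes> r = r \<otimes> (inv r \<otimes> b)" using r b by (simp add: m_assoc br)
  also have "\<dots> = b" using r b by (simp flip: m_assoc)
  finally have "r \<otimes> b = b \<otimes> inv r" using r b by (metis inv_solve_right m_closed)
  then have "b \<otimes> inv r = inv (inv r) \<otimes> b" using r by simp
  then have *: "b \<otimes> inv r [^] Suc m = r [^] Suc m \<otimes> b"
    using inverting_involution_nat_pow[of "inv r" b "Suc m"] r b by simp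
  have "r [^] k = inv r [^] Suc m"
    unfolding neg using r int_pow_neg_int[OF r, of "Suc m"] nat_pow_inv[OF r, of "Suc m"] by simp
  moreover have "r [^] (- k) = r [^] Suc m" unfolding neg by (simp only: minus_minus int_pow_int)
  ultimately show ?thesis using * by simp
qed

lemma inverting_involution_pow:
  assumes r: "r \<in> carrier G" and b: "b \<in> carrier G" and br: "b \<otimes> r = inv r \<otimes> b"
  shows "b [^] (m::nat) \<otimes> r [^] (k::int) = r [^] (if even m then k else - k) \<otimes> b [^] m"
proof (induction m arbitrary: k)
  case (Suc m)
  have "b [^] Suc m \<otimes> r [^] k = b [^] m \<otimes> (b \<otimes> r [^] k)" using r b by (simp add: m_assoc)
  also have "\<dots> = (b [^] m \<otimes> r [^] (- k)) \<otimes> b"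
    unfolding inverting_involution_int_pow[OF assms] using r b by (simp add: m_assoc)
  also have "\<dots> = r [^] (if even m then - k else k) \<otimes> b [^] Suc m"
    unfolding Suc using r b by (simp add: m_assoc)
  finally show ?case by simp
qed (use r in simp)

text \<open>Only a parity and a size bound for the exponent of \<open>r\<close> are needed, and both are
  independent of the order of the terms.\<close>

lemma dihedral_word:
  fixes e :: "'a \<Rightarrow> int" and \<delta> :: "'a \<Rightarrow> nat"
  assumes r: "r \<in> carrier G" and b: "b \<in> carrier G" and br: "b \<otimes> r = inv r \<otimes> b"
    and xs: "\<forall>x \<in> set xs. r [^] e x \<otimes> b [^] \<delta> x = x"
  shows "\<exists>k::int. lprod xs = r [^] k \<otimes> b [^] (\<Sum>x\<in>#mset xs. \<delta> x) \<and>
    \<bar>k\<bar> \<le> (\<Sum>x\<in>#mset xs. \<bar>e x\<bar>) \<and> (even k \<longleftrightarrow> even (\<Sum>x\<in>#mset xs. e x))"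
  using xs
proof (induction xs)
  case Nil
  show ?case by (rule exI[of _ 0]) simp
next
  case (Cons x xs)
  then obtain k :: int where k: "lprod xs = r [^] k \<otimes> b [^] (\<Sum>x\<in>#mset xs. \<delta> x)"
    "\<bar>k\<bar> \<le> (\<Sum>x\<in>#mset xs. \<bar>e x\<bar>)" "even k \<longleftrightarrow> even (\<Sum>x\<in>#mset xs. e x)" by auto
  let ?D = "\<Sum>x\<in>#mset xs. \<delta> x"
  define k' where "k' = (if even (\<delta> x) then k else - k)"
  have "lprod (x # xs) = (r [^] e x \<otimes> b [^] \<delta> x) \<otimes> (r [^] k \<otimes> b [^] ?D)"
    using Cons.prems k(1) by simp
  also have "\<dots> = r [^] e x \<otimes> (b [^] \<delta> x \<otimes> r [^] k) \<otimes> b [^] ?D"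
    using r b by (simp add: m_assoc)
  also have "\<dots> = (r [^] e x \<otimes> r [^] k') \<otimes> (b [^] \<delta> x \<otimes> b [^] ?D)"
    unfolding inverting_involution_pow[OF r b br] k'_def[symmetric] using r b by (simp add: m_assoc)
  also have "\<dots> = r [^] (e x + k') \<otimes> b [^] (\<delta> x + ?D)"
    using r b by (simp add: int_pow_mult nat_pow_mult)
  finally have "lprod (x # xs) = r [^] (e x + k') \<otimes> b [^] (\<Sum>x\<in>#mset (x # xs). \<delta> x)" by simp
  moreover have "\<bar>k'\<bar> = \<bar>k\<bar>" by (simp add: k'_def)
  then have "\<bar>e x + k'\<bar> \<le> (\<Sum>x\<in>#mset (x # xs). \<bar>e x\<bar>)"
    using k(2) abs_triangle_ineq[of "e x" k'] by simp
  moreover have "even (e x + k') \<longleftrightarrow> even (\<Sum>x\<in>#mset (x # xs). e x)"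
    using k(3) by (simp add: k'_def)
  ultimately show ?case by blast
qed

text \<open>If the exponent of \<open>b\<close> were odd, \<open>b\<close> would be a power of
  \<open>r\<close> and its order 2 would divide the odd \<open>ord r\<close>. With that exponent
  even the word equals \<open>r^k\<close>; an odd \<open>k\<close> is a nonzero multiple of
  \<open>ord r\<close>, and \<open>|k|\<close> is at most the sum of the absolute exponents.\<close>

lemma product_one_dihedral_word:
  fixes e :: "'a \<Rightarrow> int" and \<delta> :: "'a \<Rightarrow> nat"
  assumes r: "r \<in> carrier G" "odd (ord r)" and b: "b \<in> carrier G" "ord b = 2"
    and br: "b \<otimes> r = inv r \<otimes> b"
    and S: "product_one G S" "\<And>x. x \<in># S \<Longrightarrow> r [^] e x \<otimes> b [^] \<delta> x = x"
  shows "even (\<Sum>x\<in>#S. \<delta> x)" "odd (\<Sum>x\<in>#S. e x) \<Longrightarrow> int (ord r) \<le> (\<Sum>x\<in>#S. \<bar>e x\<bar>)"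
proof -
  obtain xs where xs: "mset xs = S" "lprod xs = \<one>" using S(1) unfolding product_one_def by blast
  have "\<forall>x \<in> set xs. r [^] e x \<otimes> b [^] \<delta> x = x" using S(2) xs(1) by auto
  from dihedral_word[OF r(1) b(1) br this] obtain k :: int where
    k: "\<one> = r [^] k \<otimes> b [^] (\<Sum>x\<in>#S. \<delta> x)" "\<bar>k\<bar> \<le> (\<Sum>x\<in>#S. \<bar>e x\<bar>)"
      "even k \<longleftrightarrow> even (\<Sum>x\<in>#S. e x)"
    unfolding xs by auto
  have b2: "b [^] m = \<one>" if "even m" for m :: nat using that b pow_eq_id by auto
  show ev: "even (\<Sum>x\<in>#S. \<delta> x)"
  proof (rule ccontr)
    assume "odd (\<Sum>x\<in>#S. \<delta> x)"
    then obtain m where "(\<Sum>x\<in>#S. \<delta> x) = Suc (2 * m)" by (auto elim: oddE)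
    then have "b [^] (\<Sum>x\<in>#S. \<delta> x) = b" using b2[of "2 * m"] b(1) by simp
    then have "r [^] k \<otimes> b = \<one>" using k(1) by simp
    then have "b = r [^] (- k)" using r(1) b(1) by (metis int_pow_closed int_pow_neg inv_equality inv_comm)
    then have "b [^] ord r = r [^] (- k * int (ord r))"
      using r(1) int_pow_int[of G "r [^] (- k)" "ord r"] int_pow_pow[OF r(1), of "- k" "int (ord r)"] by simp
    also have "\<dots> = \<one>" using int_pow_eq_id[OF r(1)] by simp
    finally have "ord b dvd ord r" using pow_eq_id[OF b(1)] by blast
    with r(2) b(2) show False by simp
  qed
  assume odd: "odd (\<Sum>x\<in>#S. e x)"
  have "r [^] k = \<one>" using k(1) b2[OF ev] r(1) by simp
  then have "int (ord r) dvd k" using int_pow_eq_id[OF r(1)] by blast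
  moreover have "k \<noteq> 0" using k(3) odd by auto
  ultimately have "int (ord r) \<le> \<bar>k\<bar>" by (auto dest!: dvd_imp_le_int)
  with k(2) show "int (ord r) \<le> (\<Sum>x\<in>#S. \<bar>e x\<bar>)" by simp
qed

section \<open>Two involutions whose product has odd order\<close>

lemma sum_mset_indicator: "(\<Sum>x\<in>#S. if x = y then c else 0) = int (count S y) * c"
  by (induction S) (auto simp: algebra_simps)

lemma sum_mset_indicator_nat: "(\<Sum>x\<in>#S. if x = y then c else 0) = count S y * c"
  by (induction S) (auto simp: algebra_simps)

text \<open>With \<open>r = x y\<close>, the letters have the normal forms \<open>x = r^0 x\<close>
  and \<open>y = r^(-1) x\<close>. The exponents of \<open>x\<close> thus add up to the length, and
  those of \<open>r\<close> count the letters \<open>y\<close> up to sign.\<close>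

lemma two_involutions_product_one:
  assumes x: "x \<in> carrier G" "ord x = 2" and y: "y \<in> carrier G" "ord y = 2" and xy: "x \<noteq> y"
    and odd: "odd (ord (x \<otimes> y))" and S: "product_one G S" "set_mset S \<subseteq> {x, y}"
  shows "even (count S x) \<longleftrightarrow> even (count S y)" "odd (count S y) \<Longrightarrow> ord (x \<otimes> y) \<le> count S y"
proof -
  define r where "r = x \<otimes> y"
  define e where "e = (\<lambda>z. if z = y then -1 else 0 :: int)"
  have xx: "x \<otimes> x = \<one>" "y \<otimes> y = \<one>" using x y ord_2_iff by auto
  have inv: "inv x = x" "inv y = y" using xx x y by (auto intro: inv_equality)
  have r: "r \<in> carrier G" "inv r = y \<otimes> x" using x y inv by (auto simp: r_def inv_mult_group)
  have "x \<otimes> r = y" using x y xx by (simp add: r_def flip: m_assoc)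
  moreover have yxx: "inv r \<otimes> x = y" unfolding r using x y xx by (simp add: m_assoc)
  ultimately have br: "x \<otimes> r = inv r \<otimes> x" by simp
  have rep: "r [^] e z \<otimes> x [^] (1::nat) = z" if "z \<in># S" for z
  proof -
    have "z = x \<or> z = y" using that S(2) by auto
    then show ?thesis
    proof
      assume "z = x"
      then show ?thesis using xy x by (simp add: e_def)
    next
      assume "z = y"
      then have "r [^] e z = inv r" using r by (simp add: e_def int_pow_neg)
      then show ?thesis using \<open>z = y\<close> yxx x by simp
    qed
  qed
  have oddr: "odd (ord r)" using odd by (simp add: r_def)
  note word = product_one_dihedral_word[OF r(1) oddr x br S(1) rep]
  have "even (size S)" using word(1) by simp
  moreover have "size S = count S x + count S y"
    by (subst mset_two_support[OF S(2) xy]) simp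
  ultimately show "even (count S x) \<longleftrightarrow> even (count S y)" by simp
  assume "odd (count S y)"
  then have "odd (\<Sum>z\<in>#S. e z)" unfolding e_def sum_mset_indicator by simp
  then have "int (ord r) \<le> (\<Sum>z\<in>#S. \<bar>e z\<bar>)" by (rule word(2)[rotated])
  also have "(\<Sum>z\<in>#S. \<bar>e z\<bar>) = (\<Sum>z\<in>#S. if z = y then 1 else 0)"
    by (intro arg_cong[of _ _ sum_mset] image_mset_cong) (simp add: e_def)
  also have "\<dots> = int (count S y)" unfolding sum_mset_indicator by simp
  finally show "ord (x \<otimes> y) \<le> count S y" by (simp add: r_def)
qed

lemma two_involutions_alternating:
  assumes x: "x \<in> carrier G" and y: "y \<in> carrier G"
  shows "product_one G (replicate_mset (ord (x \<otimes> y)) x + replicate_mset (ord (x \<otimes> y)) y)"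
proof (rule product_oneI)
  show "lprod (concat (replicate (ord (x \<otimes> y)) [x, y])) = \<one>"
    using x y by (subst lprod_concat_replicate) auto
  show "mset (concat (replicate (ord (x \<otimes> y)) [x, y])) =
      replicate_mset (ord (x \<otimes> y)) x + replicate_mset (ord (x \<otimes> y)) y"
    unfolding mset_concat_replicate by (rule multiset_eqI) simp
qed

lemma product_one_even_powers:
  assumes "x \<in> carrier G" "ord x = 2" "y \<in> carrier G" "ord y = 2" "even i" "even j"
  shows "product_one G (replicate_mset i x + replicate_mset j y)"
  using assms by (intro product_one_add) (auto simp: product_one_replicate_mset split: if_splits)

text \<open>In a splitting one part has an odd number of letters \<open>x\<close>, hence also of
  \<open>y\<close>. The lower bound, applied with the involutions in both orders, puts at least
  \<open>m\<close> of each into that part, which is everything.\<close>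

lemma two_involutions_alternating_atom:
  assumes x: "x \<in> carrier G" "ord x = 2" and y: "y \<in> carrier G" "ord y = 2" and xy: "x \<noteq> y"
    and odd: "odd (ord (x \<otimes> y))"
  shows "replicate_mset (ord (x \<otimes> y)) x + replicate_mset (ord (x \<otimes> y)) y \<in> atoms G {x, y}"
proof -
  define m where "m = ord (x \<otimes> y)"
  define U where "U = replicate_mset m x + replicate_mset m y"
  have m: "odd m" "m > 0" using odd by (auto simp: m_def intro: odd_pos)
  have cU: "count U x = m" "count U y = m" "size U = 2 * m" using xy by (auto simp: U_def)
  have UP: "product_one G U" unfolding U_def m_def using two_involutions_alternating x y by blast
  have "inv (x \<otimes> y) = y \<otimes> x"
    using x y ord_2_iff by (auto simp: inv_mult_group intro!: arg_cong2[of _ _ _ _ "(\<otimes>)"] inv_equality)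
  then have myx: "ord (y \<otimes> x) = m" using ord_inv[of "x \<otimes> y"] x y by (simp add: m_def)
  have main: "C = {#}" if BC: "U = B + C" "product_one G B" "odd (count B x)" for B C
  proof -
    have sub: "set_mset B \<subseteq> {x, y}" "set_mset B \<subseteq> {y, x}"
      using BC(1) by (auto simp: U_def dest!: arg_cong[of _ _ set_mset] split: if_splits)
    have odd2: "odd (count B y)" using two_involutions_product_one(1)[OF x y xy odd BC(2) sub(1)] BC(3) by simp
    have "m \<le> count B y"
      using two_involutions_product_one(2)[OF x y xy odd BC(2) sub(1) odd2] by (simp add: m_def)
    moreover have "m \<le> count B x"
      using two_involutions_product_one(2)[OF y x xy[symmetric] _ BC(2) sub(2) BC(3)] m myx by simp
    moreover have "size B = count B x + count B y" by (subst mset_two_support[OF sub(1) xy]) simp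
    moreover have "size B + size C = 2 * m" using cU(3) BC(1) by simp
    ultimately have "size C = 0" by linarith
    then show ?thesis by simp
  qed
  have "B = {#} \<or> C = {#}" if BC: "U = B + C" "product_one G B" "product_one G C" for B C
  proof -
    have "count B x + count C x = m" using cU(1) BC(1) by simp
    then have "odd (count B x) \<or> odd (count C x)" using m by (metis even_add)
    then show ?thesis
    proof
      assume "odd (count B x)"
      then show ?thesis using main[OF BC(1,2)] by simp
    next
      assume "odd (count C x)"
      moreover have "U = C + B" using BC(1) by (simp add: add.commute)
      ultimately show ?thesis using main[OF _ BC(3)] by simp
    qed
  qed
  moreover have "set_mset U \<subseteq> {x, y}" by (auto simp: U_def split: if_splits)
  moreover have "U \<noteq> {#}" using cU m by auto
  ultimately have "U \<in> atoms G {x, y}" using UP by (simp add: atoms_iff)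
  then show ?thesis by (simp add: U_def m_def)
qed

lemma two_involutions_lengths:
  assumes x: "x \<in> carrier G" "ord x = 2" and y: "y \<in> carrier G" "ord y = 2" and xy: "x \<noteq> y"
    and odd: "odd (ord (x \<otimes> y))" and G0: "G0 \<subseteq> {\<one>, x, y}"
    and kl: "k \<in> lengths G G0 A" "l \<in> lengths G G0 A"
  shows "2 * int (ord (x \<otimes> y)) - 2 dvd int k - int l"
proof -
  define m where "m = ord (x \<otimes> y)"
  \<comment> \<open>The identity, \<open>x x\<close> and \<open>y y\<close> get the totals 2, 2 and
    \<open>4m - 2\<close>, the alternating word gets \<open>m + m(2m - 1) = 2m^2\<close>. All are 2
    modulo \<open>4(m - 1)\<close>; for the last one this needs \<open>m + 1\<close> even.\<close>
  define f :: "'a \<Rightarrow> int" where "f = (\<lambda>z. if z = \<one> then 2 else if z = x then 1 else 2 * int m - 1)"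
  have x1: "x \<noteq> \<one>" "y \<noteq> \<one>" using x y ord_2_iff by auto
  have G0c: "G0 \<subseteq> carrier G" using G0 x y by auto
  have odd': "odd m" using odd by (simp add: m_def)
  then have m: "m \<ge> 1" by (cases m) auto
  have "inv (x \<otimes> y) = y \<otimes> x"
    using x y ord_2_iff by (auto simp: inv_mult_group intro!: arg_cong2[of _ _ _ _ "(\<otimes>)"] inv_equality)
  then have myx: "ord (y \<otimes> x) = m" using ord_inv[of "x \<otimes> y"] x y by (simp add: m_def)
  have "2 * (2 * int m - 2) dvd (\<Sum>z\<in>#W. f z) - 2" if W: "W \<in> atoms G G0" for W
  proof (cases "\<one> \<in># W")
    case True
    then have "W = {#\<one>#}" using atom_one W G0c by blast
    then show ?thesis by (simp add: f_def)
  next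
    case False
    define i j where "i = count W x" and "j = count W y"
    have sub: "set_mset W \<subseteq> {x, y}" "set_mset W \<subseteq> {y, x}" using atoms_subset[OF W] G0 False by auto
    have Weq: "W = replicate_mset i x + replicate_mset j y"
      unfolding i_def j_def by (rule mset_two_support[OF sub(1) xy])
    have WP: "product_one G W" using W by (simp add: atoms_iff)
    have par: "even i \<longleftrightarrow> even j"
      unfolding i_def j_def by (rule two_involutions_product_one(1)[OF x y xy odd WP sub(1)])
    have fW: "(\<Sum>z\<in>#W. f z) = int i + int j * (2 * int m - 1)"
      unfolding Weq using x1 xy by (simp add: f_def)
    consider "even i" "i > 0" | "i = 0" | "odd i" by auto
    then show ?thesis
    proof cases
      case 1
      then obtain i' where i': "i = 2 + i'" "even i'" by (auto elim!: evenE intro: that[of "i - 2"])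
      have "W = replicate_mset 2 x + (replicate_mset i' x + replicate_mset j y)"
        unfolding Weq i'(1) by (simp only: replicate_mset_add add.assoc)
      moreover have "product_one G (replicate_mset i' x + replicate_mset j y)"
        using product_one_even_powers x y i'(2) par 1 by blast
      moreover have "product_one G (replicate_mset 2 x)" using x by (simp add: product_one_replicate_mset)
      moreover have "replicate_mset 2 x \<noteq> {#}" by (simp add: numeral_2_eq_2)
      ultimately have "replicate_mset i' x + replicate_mset j y = {#}" using atom_split[OF W] by blast
      then have "i' = 0" "j = 0" by auto
      then show ?thesis unfolding fW i'(1) by simp
    next
      case 2
      then have "set_mset W \<subseteq> {y}" unfolding Weq by (auto split: if_splits)
      then have "W = replicate_mset 2 y" using atom_single_support[OF W _ y(1)] y(2) by simp
      then have "j = 2" by (simp add: j_def)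
      with 2 show ?thesis unfolding fW by simp
    next
      case 3
      then have "odd j" using par by simp
      have "m \<le> j"
        using two_involutions_product_one(2)[OF x y xy odd WP sub(1)] \<open>odd j\<close> by (simp add: m_def j_def)
      moreover have "m \<le> i"
        using two_involutions_product_one(2)[OF y x xy[symmetric] _ WP sub(2)] 3 odd' myx by (simp add: i_def)
      ultimately obtain i' j' where ij: "i = m + i'" "j = m + j'" by (metis le_iff_add)
      then have ev: "even i'" "even j'" using 3 \<open>odd j\<close> odd' by auto
      define U where "U = replicate_mset m x + replicate_mset m y"
      have "W = U + (replicate_mset i' x + replicate_mset j' y)"
        unfolding Weq ij U_def by (simp only: replicate_mset_add ac_simps)
      moreover have "product_one G (replicate_mset i' x + replicate_mset j' y)"
        using product_one_even_powers x y ev by blast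
      moreover have "product_one G U"
        unfolding U_def m_def using two_involutions_alternating x y by blast
      moreover have "U \<noteq> {#}" using m by (auto simp: U_def)
      ultimately have "replicate_mset i' x + replicate_mset j' y = {#}" using atom_split[OF W] by blast
      then have "i = m" "j = m" using ij by auto
      obtain t where t: "m = 2 * t + 1" using odd' by (rule oddE)
      have "(\<Sum>z\<in>#W. f z) - 2 = 2 * (2 * int m - 2) * (int t + 1)"
        unfolding fW \<open>i = m\<close> \<open>j = m\<close> t by (simp add: algebra_simps)
      then show ?thesis by simp
    qed
  qed
  then have "2 * int m - 2 dvd int k - int l" by (rule lengths_functional[OF _ _ kl]) auto
  then show ?thesis by (simp add: m_def)
qed

text \<open>The square of the alternating atom is also a product of \<open>2m\<close> squares of
  involutions, so it has lengths 2 and \<open>2m\<close>.\<close>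

lemma two_involutions_Delta_star:
  assumes x: "x \<in> carrier G" "ord x = 2" and y: "y \<in> carrier G" "ord y = 2"
    and odd: "odd (ord (x \<otimes> y))" and ge3: "ord (x \<otimes> y) \<ge> 3"
  shows "2 * ord (x \<otimes> y) - 2 \<in> Delta_star G"
proof -
  have xy: "x \<noteq> y"
  proof
    assume "x = y"
    then have "x \<otimes> y = \<one>" using x ord_2_iff by auto
    with ge3 show False by simp
  qed
  define m where "m = ord (x \<otimes> y)"
  define U where "U = replicate_mset m x + replicate_mset m y"
  have U: "U \<in> atoms G {x, y}"
    unfolding U_def m_def by (rule two_involutions_alternating_atom[OF x y xy odd])
  have "2 * m - 2 \<in> Delta_star G"
  proof (rule Delta_starI)
    show car: "{x, y} \<subseteq> carrier G" using x y by simp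
    show "2 \<in> lengths G {x, y} (repeat_mset 2 U)" by (rule lengths_atom_power[OF U])
    have "\<forall>z \<in># U. ord z = 2" using x y by (auto simp: U_def split: if_splits)
    then have "(\<Sum>z\<in>#U. replicate_mset (ord z) z) = (\<Sum>z\<in>#U. replicate_mset 2 z)"
      by (intro arg_cong[of _ _ sum_mset] image_mset_cong) simp
    also have "\<dots> = repeat_mset 2 U" by (induction U) (auto simp: numeral_2_eq_2)
    finally have "size U \<in> lengths G {x, y} (repeat_mset 2 U)"
      using lengths_ord_powers[OF atoms_subset[OF U] car] by simp
    moreover have "size U = 2 + (2 * m - 2)" using ge3 by (simp add: U_def m_def)
    ultimately show "2 + (2 * m - 2) \<in> lengths G {x, y} (repeat_mset 2 U)" by simp
    show "1 \<le> 2 * m - 2" using ge3 by (simp add: m_def)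
    fix B i j assume ij: "i \<in> lengths G {x, y} B" "j \<in> lengths G {x, y} B"
    have "2 * int m - 2 dvd int i - int j"
      unfolding m_def by (rule two_involutions_lengths[OF x y xy odd _ ij]) auto
    moreover have "int (2 * m - 2) = 2 * int m - 2" using ge3 by (simp add: m_def of_nat_diff)
    ultimately show "int (2 * m - 2) dvd int i - int j" by simp
  qed
  then show ?thesis by (simp add: m_def)
qed

end

section \<open>Dihedral groups of order \<open>2n\<close> with \<open>n\<close> odd\<close>

locale odd_dihedral = finite_group +
  fixes n :: nat and a b
  assumes n: "odd n" "n \<ge> 3" and order_2n: "order G = 2 * n"
    and a: "a \<in> carrier G" "ord a = n" and b: "b \<in> carrier G" "ord b = 2"
    and conj: "b \<otimes> a \<otimes> inv b = inv a"
begin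

section \<open>Rotations and reflections\<close>

lemma b_sq: "b \<otimes> b = \<one>" "b \<noteq> \<one>"
  using b ord_2_iff by auto

lemma b_a: "b \<otimes> a = inv a \<otimes> b"
proof -
  have "b \<otimes> a = b \<otimes> a \<otimes> inv b \<otimes> b" using a b by (simp add: m_assoc)
  then show ?thesis unfolding conj .
qed

lemma b_a_pow: "b \<otimes> a [^] (k::int) = a [^] (- k) \<otimes> b"
  by (rule inverting_involution_int_pow[OF a(1) b(1) b_a])

definition rotations :: "'a set" where "rotations = generate G {a}"

lemma rotations_subgroup: "subgroup rotations G"
  unfolding rotations_def using a by (intro generate_is_subgroup) auto

lemma rotations_carrier: "rotations \<subseteq> carrier G"
  using subgroup.subset[OF rotations_subgroup] .

lemma card_rotations: "card rotations = n"
  using generate_pow_card[OF a(1)] a(2) by (simp add: rotations_def)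

lemma rotations_eq: "rotations = range (\<lambda>k::int. a [^] k)"
  unfolding rotations_def generate_pow[OF a(1)] by auto

text \<open>The order divides the odd number \<open>n\<close>. Odd order is later what separates
  rotations from elements of order two.\<close>

lemma rotation_odd_ord:
  assumes "g \<in> rotations" shows "odd (ord g)" "ord g \<le> n"
proof -
  obtain k :: int where g: "g = a [^] k" using assms rotations_eq by auto
  have "g [^] n = \<one>"
    using int_pow_int[of G g n] int_pow_pow[OF a(1), of k "int n"] int_pow_eq_id[OF a(1), of "k * int n"]
    unfolding g a(2) by simp
  then have dvd: "ord g dvd n" using pow_eq_id a(1) g by auto
  then show "odd (ord g)" using n(1) by (auto dest: dvd_trans)
  show "ord g \<le> n" using dvd n by (intro dvd_imp_le) auto
qed

text \<open>\<open>b\<close> has even order and is no rotation, so the rotations and their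
  translates by \<open>b\<close> are disjoint sets of size \<open>n\<close> and fill all
  \<open>2 * n\<close> elements.\<close>

lemma reflection_form:
  assumes t: "t \<in> carrier G - rotations" shows "\<exists>k::int. t = a [^] k \<otimes> b"
proof -
  have fin: "finite rotations" using rotations_carrier finite_carrier finite_subset by blast
  have "b \<notin> rotations" using rotation_odd_ord(1)[of b] b(2) by auto
  have inj: "inj_on (\<lambda>g. g \<otimes> b) rotations"
    using rotations_carrier b(1) by (intro inj_onI) (simp add: subset_iff)
  have disj: "rotations \<inter> (\<lambda>g. g \<otimes> b) ` rotations = {}"
  proof (rule equals0I)
    fix u assume "u \<in> rotations \<inter> (\<lambda>g. g \<otimes> b) ` rotations"
    then obtain g where g: "g \<in> rotations" "g \<otimes> b \<in> rotations" by auto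
    then have "inv g \<otimes> (g \<otimes> b) \<in> rotations"
      using subgroup.m_closed[OF rotations_subgroup] subgroup.m_inv_closed[OF rotations_subgroup] by blast
    moreover have "inv g \<otimes> (g \<otimes> b) = b"
      using g(1) rotations_carrier b(1) by (simp add: subset_iff flip: m_assoc)
    ultimately show False using \<open>b \<notin> rotations\<close> by simp
  qed
  have "card (rotations \<union> (\<lambda>g. g \<otimes> b) ` rotations) = 2 * n"
    using card_Un_disjoint[OF fin _ disj] fin card_image[OF inj] card_rotations by simp
  moreover have "rotations \<union> (\<lambda>g. g \<otimes> b) ` rotations \<subseteq> carrier G"
    using rotations_carrier b(1) by auto
  ultimately have "rotations \<union> (\<lambda>g. g \<otimes> b) ` rotations = carrier G"
    using order_2n finite_carrier by (intro card_subset_eq) (auto simp: order_def)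
  then have "t \<in> (\<lambda>g. g \<otimes> b) ` rotations" using t by blast
  then show ?thesis unfolding rotations_eq by auto
qed

lemma reflection_ord:
  assumes t: "t \<in> carrier G - rotations" shows "ord t = 2"
proof -
  obtain k :: int where k: "t = a [^] k \<otimes> b" using reflection_form[OF t] ..
  have "t \<otimes> t = a [^] k \<otimes> (b \<otimes> a [^] k) \<otimes> b"
    unfolding k using a(1) b(1) by (simp add: m_assoc)
  also have "\<dots> = (a [^] k \<otimes> a [^] (- k)) \<otimes> (b \<otimes> b)"
    unfolding b_a_pow using a(1) b(1) by (simp add: m_assoc)
  also have "\<dots> = \<one>" using a(1) b_sq by (simp add: int_pow_neg)
  finally have "t \<otimes> t = \<one>" .
  moreover have "t \<noteq> \<one>" using t subgroup.one_closed[OF rotations_subgroup] by auto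
  ultimately show ?thesis using t ord_2_iff[of t] by simp
qed

lemma reflection_inverts:
  assumes t: "t \<in> carrier G - rotations" and g: "g \<in> rotations" shows "t \<otimes> g = inv g \<otimes> t"
proof -
  obtain k :: int where k: "t = a [^] k \<otimes> b" using reflection_form[OF t] ..
  obtain j :: int where j: "g = a [^] j" using g rotations_eq by auto
  have "t \<otimes> g = a [^] k \<otimes> (b \<otimes> a [^] j)" unfolding k j using a(1) b(1) by (simp add: m_assoc)
  also have "\<dots> = (a [^] k \<otimes> a [^] (- j)) \<otimes> b" unfolding b_a_pow using a(1) b(1) by (simp add: m_assoc)
  also have "a [^] k \<otimes> a [^] (- j) = a [^] (- j) \<otimes> a [^] k"
    using a(1) by (simp only: int_pow_mult[symmetric] add.commute)
  also have "a [^] (- j) \<otimes> a [^] k \<otimes> b = inv g \<otimes> t"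
    unfolding k j using a(1) b(1) by (simp add: int_pow_neg m_assoc)
  finally show ?thesis .
qed

lemma reflection_mult:
  assumes t: "t \<in> carrier G - rotations" and u: "u \<in> carrier G - rotations"
  shows "t \<otimes> u \<in> rotations"
proof -
  obtain k :: int where k: "t = a [^] k \<otimes> b" using reflection_form[OF t] ..
  obtain j :: int where j: "u = a [^] j \<otimes> b" using reflection_form[OF u] ..
  have "t \<otimes> u = a [^] k \<otimes> (b \<otimes> a [^] j) \<otimes> b" unfolding k j using a(1) b(1) by (simp add: m_assoc)
  also have "\<dots> = (a [^] k \<otimes> a [^] (- j)) \<otimes> (b \<otimes> b)"
    unfolding b_a_pow using a(1) b(1) by (simp add: m_assoc)
  also have "\<dots> = a [^] (k + - j)" using a(1) b_sq by (simp only: int_pow_mult r_one m_closed int_pow_closed)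
  finally show ?thesis unfolding rotations_eq by blast
qed

text \<open>The product of two distinct reflections is a nontrivial rotation, and an odd order other
  than 1 is at least 3.\<close>

lemma reflection_pair_ord:
  assumes t: "t \<in> carrier G - rotations" and u: "u \<in> carrier G - rotations" and "t \<noteq> u"
  shows "odd (ord (t \<otimes> u))" "ord (t \<otimes> u) \<le> n" "ord (t \<otimes> u) \<ge> 3"
proof -
  show odd: "odd (ord (t \<otimes> u))" and "ord (t \<otimes> u) \<le> n"
    using rotation_odd_ord reflection_mult[OF t u] by auto
  have "ord (t \<otimes> u) \<noteq> 1"
  proof
    assume "ord (t \<otimes> u) = 1"
    then have "t \<otimes> u = t \<otimes> t" using t u ord_eq_1[of "t \<otimes> u"] reflection_ord[OF t] ord_2_iff[of t] by simp
    then show False using t u \<open>t \<noteq> u\<close> by simp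
  qed
  moreover have "ord (t \<otimes> u) \<noteq> 2" using odd by auto
  moreover have "ord (t \<otimes> u) \<noteq> 0" using odd by (metis even_zero)
  ultimately show "ord (t \<otimes> u) \<ge> 3" by linarith
qed

lemma b_reflection: "b \<in> carrier G - rotations"
  using rotation_odd_ord(1)[of b] b by auto

lemma ab_reflection: "a \<otimes> b \<in> carrier G - rotations" "(a \<otimes> b) \<otimes> b = a"
proof -
  have eq: "(a \<otimes> b) \<otimes> b = a" using a b b_sq by (simp add: m_assoc)
  then show "(a \<otimes> b) \<otimes> b = a" .
  have "a \<otimes> b \<notin> rotations"
  proof
    assume "a \<otimes> b \<in> rotations"
    moreover have "a \<in> rotations" unfolding rotations_def by (simp add: generate.incl)
    ultimately have "inv a \<otimes> (a \<otimes> b) \<in> rotations"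
      using subgroup.m_closed[OF rotations_subgroup] subgroup.m_inv_closed[OF rotations_subgroup] by blast
    moreover have "inv a \<otimes> (a \<otimes> b) = b" using a b by (simp flip: m_assoc)
    ultimately show False using b_reflection by simp
  qed
  then show "a \<otimes> b \<in> carrier G - rotations" using a b by simp
qed

text \<open>The reflections \<open>a b\<close> and \<open>b\<close> have product \<open>a\<close>,
  whose order is \<open>n\<close>.\<close>

lemma max_in_Delta_star: "2 * n - 2 \<in> Delta_star G"
  using two_involutions_Delta_star[of "a \<otimes> b" b] ab_reflection reflection_ord b a n by auto

text \<open>The word \<open>g t g t\<close> is the identity because \<open>t\<close> inverts
  \<open>g\<close>. A part with exactly one \<open>t\<close> has a single term outside the
  rotations, so both \<open>t\<close> stay together; the other part could only be \<open>g\<close>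
  or \<open>g g\<close>, which the odd order of \<open>g\<close> excludes.\<close>

lemma rotation_reflection_atom:
  assumes g: "g \<in> rotations" "g \<noteq> \<one>" and t: "t \<in> carrier G - rotations"
  shows "{#g, g, t, t#} \<in> atoms G {g, t}"
proof -
  have gt: "g \<in> carrier G" "t \<in> carrier G" using g t rotations_carrier by auto
  have tt: "t \<otimes> t = \<one>" "t \<noteq> \<one>" using gt reflection_ord[OF t] ord_2_iff by auto
  have "ord g \<noteq> 1" "odd (ord g)" using gt g ord_eq_1 rotation_odd_ord by auto
  then have og: "\<not> ord g dvd 1" "\<not> ord g dvd 2" by (auto dest!: dvd_imp_le elim!: oddE)
  have ng: "\<not> product_one G (replicate_mset j g)" if "j = 1 \<or> j = 2" for j
    using that og gt(1) by (auto simp: product_one_replicate_mset simp del: replicate_mset_Suc)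
  have "lprod [g, t, g, t] = g \<otimes> (t \<otimes> g) \<otimes> t" using gt by (simp add: m_assoc)
  also have "\<dots> = (g \<otimes> inv g) \<otimes> (t \<otimes> t)"
    unfolding reflection_inverts[OF t g(1)] using gt by (simp flip: m_assoc)
  also have "\<dots> = \<one>" using gt tt by simp
  finally have P: "product_one G {#g, g, t, t#}" by (rule product_oneI) simp
  have tR: "t \<notin> rotations" using t by simp
  have gtne: "g \<noteq> t" using g t by auto
  have single_t: "\<not> product_one G (add_mset t S)" if "set_mset S \<subseteq> {g}" for S
    using product_one_mem_subgroup[OF rotations_subgroup gt(2)] that g(1) tR by blast
  have main: "C = {#}"
    if BC: "{#g, g, t, t#} = B + C" "product_one G B" "product_one G C" "t \<in># B" for B C
  proof -
    obtain B' where B': "B = add_mset t B'" using BC(4) by (meson multi_member_split)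
    have eq: "{#g, g, t#} = B' + C" using BC(1) unfolding B' by (simp add: add_mset_commute)
    have "t \<in># B' + C" unfolding eq[symmetric] by simp
    then consider "t \<in># B'" | "t \<in># C" by auto
    then show ?thesis
    proof cases
      case 1
      then obtain B'' where "B' = add_mset t B''" by (meson multi_member_split)
      then have eq2: "{#g, g#} = B'' + C" using eq by (simp add: add_mset_commute)
      then have "C \<subseteq># replicate_mset 2 g" by (simp add: numeral_2_eq_2)
      then obtain j where j: "C = replicate_mset j g" "j \<le> 2" by (metis msubseteq_replicate_msetE)
      have "\<not> (j = 1 \<or> j = 2)" using ng[of j] BC(3) j(1) by blast
      then have "j = 0" using j(2) by linarith
      then show ?thesis using j by simp
    next
      case 2
      then obtain C' where C': "C = add_mset t C'" by (meson multi_member_split)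
      then have "{#g, g#} = B' + C'" using eq by (simp add: add_mset_commute)
      then have "set_mset B' \<subseteq> {g}" by (auto dest!: arg_cong[of _ _ set_mset])
      then show ?thesis using single_t BC(2) B' by blast
    qed
  qed
  have "B = {#} \<or> C = {#}" if BC: "{#g, g, t, t#} = B + C" "product_one G B" "product_one G C" for B C
  proof -
    have "t \<in># B + C" unfolding BC(1)[symmetric] by simp
    then consider "t \<in># B" | "t \<in># C" by auto
    then show ?thesis
    proof cases
      case 1
      then show ?thesis using main[OF BC] by simp
    next
      case 2
      have "{#g, g, t, t#} = C + B" using BC(1) by (simp add: add.commute)
      then show ?thesis using main[OF _ BC(3,2)] 2 by simp
    qed
  qed
  then show ?thesis using P by (simp add: atoms_iff)
qed

text \<open>Regrouping \<open>ord g\<close> copies of \<open>g g t t\<close> gives two powers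
  \<open>g^(ord g)\<close> and \<open>ord g\<close> pairs \<open>t t\<close>, two atoms more than
  before.\<close>

lemma rotation_reflection_lengths:
  assumes G0: "G0 \<subseteq> carrier G" and g: "g \<in> G0" "g \<in> rotations" "g \<noteq> \<one>"
    and t: "t \<in> G0" "t \<notin> rotations"
  defines "A \<equiv> repeat_mset (ord g) {#g, g, t, t#}"
  shows "ord g \<in> lengths G G0 A" "ord g + 2 \<in> lengths G G0 A"
proof -
  have gt: "g \<in> carrier G" "t \<in> carrier G" "t \<in> carrier G - rotations" using g t G0 by auto
  have "{#g, g, t, t#} \<in> atoms G G0"
    using atoms_mono[OF rotation_reflection_atom[OF g(2,3) gt(3)]] g t by simp
  then show "ord g \<in> lengths G G0 A" unfolding A_def by (rule lengths_atom_power)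
  have "A = repeat_mset (ord g) (replicate_mset 2 t) + repeat_mset 2 (replicate_mset (ord g) g)"
    unfolding A_def by (rule multiset_eqI) simp
  moreover have "replicate_mset 2 t \<in> atoms G G0"
    using atom_ord_power'[OF gt(2) t(1)] reflection_ord[OF gt(3)] by simp
  moreover have "replicate_mset (ord g) g \<in> atoms G G0" by (rule atom_ord_power'[OF gt(1) g(1)])
  ultimately show "ord g + 2 \<in> lengths G G0 A"
    using lengths_add[OF lengths_atom_power lengths_atom_power] by metis
qed

text \<open>The word \<open>a^p b a^p b\<close> is the identity, and the other reflections cancel in
  pairs. One pair is spent on inverting \<open>a^p\<close>, hence \<open>q >= 1\<close>.\<close>

lemma product_one_rotation_reflections:
  assumes "q \<ge> 1" shows "product_one G (replicate_mset (2 * p) a + replicate_mset (2 * q) b)"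
proof -
  have "lprod (replicate p a @ [b] @ replicate p a @ [b]) = a [^] p \<otimes> (b \<otimes> a [^] p) \<otimes> b"
    using a b by (simp add: lprod_replicate m_assoc set_replicate_conv_if del: foldr_replicate)
  also have "\<dots> = (a [^] p \<otimes> inv (a [^] p)) \<otimes> (b \<otimes> b)"
    using inverting_involution_nat_pow[OF a(1) b(1) b_a, of p] a b
    by (simp add: nat_pow_inv flip: m_assoc)
  also have "\<dots> = \<one>" using a b_sq by simp
  finally have "product_one G (replicate_mset (2 * p) a + {#b, b#})"
    by (rule product_oneI) (simp add: mult_2 replicate_mset_add)
  moreover have "product_one G (replicate_mset (2 * (q - 1)) b)"
    using b by (simp add: product_one_replicate_mset)
  ultimately have "product_one G ((replicate_mset (2 * p) a + {#b, b#}) + replicate_mset (2 * (q - 1)) b)"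
    by (rule product_one_add) (use a b in \<open>auto split: if_splits\<close>)
  moreover have "(replicate_mset (2 * p) a + {#b, b#}) + replicate_mset (2 * (q - 1)) b =
      replicate_mset (2 * p) a + replicate_mset (2 * q) b"
    using assms by (intro multiset_eqI) auto
  ultimately show ?thesis by (simp only:)
qed

text \<open>In the normal form \<open>a = a^1 b^0\<close> and \<open>b = a^0 b^1\<close>, the two
  exponent sums count the two letters.\<close>

lemma rotation_reflection_parity:
  assumes S: "product_one G S" "set_mset S \<subseteq> {a, b}"
  shows "even (count S b)" "odd (count S a) \<Longrightarrow> n \<le> count S a"
proof -
  have ab: "a \<noteq> b" using a b n by auto
  define e where "e = (\<lambda>z. if z = a then 1 else 0 :: int)"
  define \<delta> where "\<delta> = (\<lambda>z. if z = b then 1 else 0 :: nat)"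
  have rep: "a [^] e z \<otimes> b [^] \<delta> z = z" if "z \<in># S" for z
  proof -
    have "z = a \<or> z = b" using that S(2) by auto
    then show ?thesis using a b ab by (auto simp: e_def \<delta>_def)
  qed
  have "odd (ord a)" using a n by simp
  note word = product_one_dihedral_word[OF a(1) this b b_a S(1) rep]
  have "even (\<Sum>z\<in>#S. \<delta> z)" by (rule word(1))
  then show "even (count S b)" unfolding \<delta>_def sum_mset_indicator_nat by simp
  assume "odd (count S a)"
  then have "odd (\<Sum>z\<in>#S. e z)" unfolding e_def sum_mset_indicator by simp
  then have "int (ord a) \<le> (\<Sum>z\<in>#S. \<bar>e z\<bar>)" by (rule word(2)[rotated])
  also have "(\<Sum>z\<in>#S. \<bar>e z\<bar>) = (\<Sum>z\<in>#S. if z = a then 1 else 0)"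
    by (intro arg_cong[of _ _ sum_mset] image_mset_cong) (simp add: e_def)
  also have "\<dots> = int (count S a)" unfolding sum_mset_indicator by simp
  finally show "n \<le> count S a" using a(2) by simp
qed

lemma two_in_Delta_star: "2 \<in> Delta_star G"
proof (rule Delta_starI)
  have ab: "a \<noteq> b" using a b n by auto
  have a1: "a \<noteq> \<one>" using a n by auto
  have aR: "a \<in> rotations" unfolding rotations_def by (simp add: generate.incl)
  show car: "{a, b} \<subseteq> carrier G" using a b by simp
  have len: "ord a \<in> lengths G {a, b} (repeat_mset (ord a) {#a, a, b, b#})"
    "ord a + 2 \<in> lengths G {a, b} (repeat_mset (ord a) {#a, a, b, b#})"
    using rotation_reflection_lengths[OF car, of a b] aR a1 b_reflection by auto
  then show "n \<in> lengths G {a, b} (repeat_mset n {#a, a, b, b#})"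
    "n + 2 \<in> lengths G {a, b} (repeat_mset n {#a, a, b, b#})"
    unfolding a(2) by auto
  show "(1::nat) \<le> 2" by simp
  \<comment> \<open>The weights 2 and 1 give \<open>a^n\<close> the total \<open>2n\<close> and
    \<open>a^(2p) b^2\<close> the total \<open>4p + 2\<close>, both 2 modulo 4, the former because
    \<open>n\<close> is odd. Atoms over \<open>a\<close> and \<open>b\<close> have no other
    shape.\<close>
  define f :: "'a \<Rightarrow> int" where "f = (\<lambda>z. if z = a then 2 else 1)"
  have f: "2 * 2 dvd (\<Sum>z\<in>#W. f z) - 2" if W: "W \<in> atoms G {a, b}" for W
  proof -
    define i j where "i = count W a" and "j = count W b"
    have sub: "set_mset W \<subseteq> {a, b}" by (rule atoms_subset[OF W])
    have Weq: "W = replicate_mset i a + replicate_mset j b"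
      unfolding i_def j_def by (rule mset_two_support[OF sub ab])
    have WP: "product_one G W" using W by (simp add: atoms_iff)
    have fW: "(\<Sum>z\<in>#W. f z) = 2 * int i + int j" unfolding Weq using ab by (simp add: f_def)
    have ej: "even j" unfolding j_def by (rule rotation_reflection_parity(1)[OF WP sub])
    have oi: "n \<le> i" if "odd i" using rotation_reflection_parity(2)[OF WP sub] that by (simp add: i_def)
    show ?thesis
    proof (cases "j = 0")
      case True
      then have "set_mset W \<subseteq> {a}" unfolding Weq by (auto split: if_splits)
      then have "W = replicate_mset n a" using atom_single_support[OF W _ a(1)] a(2) by simp
      then have "i = n" by (simp add: i_def)
      obtain s where "n = 2 * s + 1" using n(1) by (rule oddE)
      then show ?thesis unfolding fW True \<open>i = n\<close> by simp
    next
      case False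
      then obtain q where q: "j = 2 * q" "q \<ge> 1" using ej by (auto elim!: evenE)
      \<comment> \<open>An odd number of rotations is at least \<open>n\<close>, so
        \<open>a^n\<close> would split off and leave an even number.\<close>
      have "even i"
      proof (rule ccontr)
        assume "odd i"
        then obtain i' where i': "i = n + i'" using oi by (metis le_iff_add)
        then obtain p where p: "i' = 2 * p" using \<open>odd i\<close> n(1) by (auto elim!: evenE)
        have "W = replicate_mset n a + (replicate_mset (2 * p) a + replicate_mset (2 * q) b)"
          unfolding Weq i' p q by (simp only: replicate_mset_add add.assoc)
        moreover have "product_one G (replicate_mset n a)" using a by (simp add: product_one_replicate_mset)
        moreover have "replicate_mset n a \<noteq> {#}" using n by auto
        ultimately have "replicate_mset (2 * p) a + replicate_mset (2 * q) b = {#}"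
          using atom_split[OF W] product_one_rotation_reflections[OF q(2)] by blast
        with q show False by auto
      qed
      then obtain p where p: "i = 2 * p" by (rule evenE)
      \<comment> \<open>With four or more reflections a pair \<open>b b\<close> splits off, since
        one remaining pair suffices to cancel the rotations.\<close>
      have "q = 1"
      proof (rule ccontr)
        assume "q \<noteq> 1"
        with q have q': "q = 1 + (q - 1)" "q - 1 \<ge> 1" by auto
        have j: "j = 2 + 2 * (q - 1)" using q q' by linarith
        have "W = replicate_mset 2 b + (replicate_mset (2 * p) a + replicate_mset (2 * (q - 1)) b)"
          unfolding Weq p j by (simp only: replicate_mset_add ac_simps)
        moreover have "product_one G (replicate_mset 2 b)" using b by (simp add: product_one_replicate_mset)
        moreover have "replicate_mset 2 b \<noteq> {#}" by (simp add: numeral_2_eq_2)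
        ultimately have "replicate_mset (2 * p) a + replicate_mset (2 * (q - 1)) b = {#}"
          using atom_split[OF W] product_one_rotation_reflections[OF q'(2)] by blast
        with q' show False by auto
      qed
      then show ?thesis unfolding fW p q(1) by simp
    qed
  qed
  fix B i j assume ij: "i \<in> lengths G {a, b} B" "j \<in> lengths G {a, b} B"
  have "2 dvd int i - int j" by (rule lengths_functional[OF f _ ij]) auto
  then show "int 2 dvd int i - int j" by simp
qed

text \<open>Let \<open>r = y x\<close> and \<open>z x = r^c\<close> with \<open>0 < c < n\<close>.
  The words \<open>z y (x y)^(c-1)\<close> and \<open>z x (y x)^(n-c)\<close> have product one and
  contain \<open>z\<close> once, so by parity their lengths \<open>2c\<close> and
  \<open>2 + 2(n - c)\<close> are at least \<open>d + 2\<close>, hence at least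
  \<open>n + 1\<close>. Only \<open>2c = n + 1\<close> is possible, and then
  \<open>r^(2c) = r\<close>.\<close>

lemma three_reflections:
  assumes G0: "G0 \<subseteq> carrier G" and refl: "x \<in> G0 - rotations" "y \<in> G0 - rotations" "z \<in> G0 - rotations"
    and ne: "x \<noteq> y" "x \<noteq> z" "y \<noteq> z" and ordn: "ord (y \<otimes> x) = n" and d: "n \<le> min_distance G G0 + 1"
  shows "(z \<otimes> x) \<otimes> (z \<otimes> x) = y \<otimes> x"
proof -
  define r where "r = y \<otimes> x"
  have R: "x \<in> carrier G - rotations" "y \<in> carrier G - rotations" "z \<in> carrier G - rotations"
    using refl G0 by auto
  then have car: "x \<in> carrier G" "y \<in> carrier G" "z \<in> carrier G" by auto
  have ord2: "ord x = 2" "ord y = 2" "ord z = 2" using R reflection_ord by auto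
  have sq: "x \<otimes> x = \<one>" "y \<otimes> y = \<one>" "z \<otimes> z = \<one>" using car ord2 ord_2_iff by auto
  have inv: "inv x = x" "inv y = y" using sq car by (auto intro: inv_equality)
  have r: "r \<in> carrier G" "ord r = n" "r \<in> rotations" "inv r = x \<otimes> y"
    using car ordn reflection_mult R inv by (auto simp: r_def inv_mult_group)
  have "generate G {r} \<subseteq> rotations"
    using generate_subgroup_incl[OF _ rotations_subgroup] r(3) by simp
  \<comment> \<open>Having the full order \<open>n\<close>, the rotation \<open>r\<close> generates
    all rotations, so \<open>z x\<close> is one of its powers.\<close>
  then have gen: "generate G {r} = rotations"
    using generate_pow_card[OF r(1)] r(2) card_rotations rotations_carrier finite_carrier
    by (intro card_subset_eq) (auto intro: finite_subset)
  have "z \<otimes> x \<in> rotations" using reflection_mult R by blast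
  then have "z \<otimes> x \<in> {r [^] k | k. k \<in> (UNIV :: nat set)}"
    using generate_pow_on_finite_carrier[OF finite_carrier r(1)] gen by simp
  then obtain k :: nat where "z \<otimes> x = r [^] k" by blast
  define c where "c = k mod n"
  have "r [^] k = r [^] (n * (k div n) + c)" by (simp add: c_def)
  also have "\<dots> = r [^] c" using r by (simp flip: nat_pow_mult nat_pow_pow add: r(2)[symmetric])
  finally have zx: "z \<otimes> x = r [^] c" using \<open>z \<otimes> x = r [^] k\<close> by simp
  have "c < n" using n by (simp add: c_def)
  have "c \<noteq> 0"
  proof
    assume "c = 0"
    then have "z \<otimes> x = x \<otimes> x" using zx sq by simp
    then show False using car ne by simp
  qed
  define c' where "c' = c - 1"
  have c: "c = Suc c'" using \<open>c \<noteq> 0\<close> by (simp add: c'_def)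
  have long: "min_distance G G0 + 2 \<le> size S"
    if S: "product_one G S" "set_mset S \<subseteq> {x, y, z}" "odd (count S z)" for S
  proof (rule ccontr)
    assume "\<not> ?thesis"
    then have "size S < min_distance G G0 + 2" by simp
    then have "even (count S z)"
      using S(2) ord2 refl by (intro even_count_of_short_sequence[OF G0 S(1)]) auto
    with S(3) show False by simp
  qed
  have z: "z = r [^] c \<otimes> x" using zx[symmetric] car sq by (simp add: m_assoc)
  have "lprod (z # y # concat (replicate c' [x, y])) = r [^] c \<otimes> ((x \<otimes> y) \<otimes> (x \<otimes> y) [^] c')"
    using car r by (simp add: lprod_concat_replicate z m_assoc)
  also have "\<dots> = r [^] c \<otimes> inv r [^] c"
    unfolding c r(4)[symmetric] using r(1) by (simp only: nat_pow_Suc2 inv_closed)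
  also have "\<dots> = \<one>" using r(1) by (simp add: nat_pow_inv)
  finally have "lprod (z # y # concat (replicate c' [x, y])) = \<one>" .
  then have P1: "product_one G (mset (z # y # concat (replicate c' [x, y])))" by (rule product_oneI) simp
  have e1: "mset (z # y # concat (replicate c' [x, y])) = {#z, y#} + repeat_mset c' {#x, y#}"
    by (simp add: mset_concat_replicate)
  have "min_distance G G0 + 2 \<le> size ({#z, y#} + repeat_mset c' {#x, y#})"
    using ne by (intro long P1[unfolded e1]) (auto dest!: subsetD[OF set_mset_repeat_mset_subset])
  then have 1: "n + 1 \<le> 2 * c" using d c by simp
  have "lprod (z # x # concat (replicate (n - c) [y, x])) = (z \<otimes> x) \<otimes> r [^] (n - c)"
    using car by (simp add: lprod_concat_replicate m_assoc r_def)
  also have "\<dots> = r [^] (c + (n - c))" unfolding zx using r(1) by (rule nat_pow_mult)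
  also have "c + (n - c) = ord r" using \<open>c < n\<close> r(2) by simp
  also have "r [^] ord r = \<one>" using r(1) by simp
  finally have "lprod (z # x # concat (replicate (n - c) [y, x])) = \<one>" .
  then have P2: "product_one G (mset (z # x # concat (replicate (n - c) [y, x])))" by (rule product_oneI) simp
  have e2: "mset (z # x # concat (replicate (n - c) [y, x])) = {#z, x#} + repeat_mset (n - c) {#y, x#}"
    by (simp add: mset_concat_replicate)
  have "min_distance G G0 + 2 \<le> size ({#z, x#} + repeat_mset (n - c) {#y, x#})"
    using ne by (intro long P2[unfolded e2]) (auto dest!: subsetD[OF set_mset_repeat_mset_subset])
  then have 2: "n + 1 \<le> 2 + 2 * (n - c)" using d by simp
  have "c + c = n + 1" using 1 2 \<open>c < n\<close> by linarith
  then have "(z \<otimes> x) \<otimes> (z \<otimes> x) = r [^] (n + 1)"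
    unfolding zx using nat_pow_mult[OF r(1), of c c] by simp
  also have "\<dots> = r [^] n \<otimes> r" by simp
  also have "r [^] n = \<one>" using pow_ord_eq_1[OF r(1)] r(2) by simp
  finally show ?thesis using r(1) by (simp add: r_def[symmetric])
qed

lemma reflection_pair_dvd:
  assumes G0: "G0 \<subseteq> carrier G" and x: "x \<in> G0 - rotations" and y: "y \<in> G0 - rotations" and ne: "x \<noteq> y"
  shows "min_distance G G0 dvd 2 * ord (x \<otimes> y) - 2"
proof -
  have R: "x \<in> carrier G - rotations" "y \<in> carrier G - rotations" using x y G0 by auto
  then have ord2: "ord x = 2" "ord y = 2" using reflection_ord by auto
  have m: "odd (ord (x \<otimes> y))" "ord (x \<otimes> y) \<ge> 3" using reflection_pair_ord[OF R ne] by auto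
  define U where "U = replicate_mset (ord (x \<otimes> y)) x + replicate_mset (ord (x \<otimes> y)) y"
  have Uxy: "U \<in> atoms G {x, y}"
    unfolding U_def using R ord2 ne m by (intro two_involutions_alternating_atom) auto
  have U: "U \<in> atoms G G0" using atoms_mono[OF Uxy] atoms_subset[OF Uxy] x y by blast
  have "\<forall>u \<in># U. ord u = 2" using ord2 by (auto simp: U_def split: if_splits)
  from involutive_atom_distance[OF G0 U this]
  have "int (min_distance G G0) dvd int (size U) - 2" .
  moreover have "int (size U) - 2 = int (2 * ord (x \<otimes> y) - 2)" using m(2) by (simp add: U_def of_nat_diff)
  ultimately show ?thesis by (simp only: of_nat_dvd_iff)
qed

text \<open>The weight argument makes the minimal distance a positive multiple of
  \<open>2n - 2\<close>, and the order of the group bounds it by the same number.\<close>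

lemma min_distance_two_reflections:
  assumes G0: "G0 \<subseteq> {\<one>, x, y}" and x: "x \<in> carrier G - rotations" and y: "y \<in> carrier G - rotations"
    and ordn: "ord (x \<otimes> y) = n" and ne: "x \<noteq> y" and D: "Delta G G0 \<noteq> {}"
  shows "min_distance G G0 = 2 * n - 2"
proof -
  have car: "G0 \<subseteq> carrier G" using G0 x y by auto
  obtain A k where A: "k \<in> lengths G G0 A" "k + min_distance G G0 \<in> lengths G G0 A" "min_distance G G0 \<ge> 1"
    by (rule min_distance_properties[OF car D])
  have "2 * int (ord (x \<otimes> y)) - 2 dvd int (k + min_distance G G0) - int k"
    using x y reflection_ord ne ordn n by (intro two_involutions_lengths[OF _ _ _ _ _ _ G0 A(2,1)]) auto
  moreover have "2 * int (ord (x \<otimes> y)) - 2 = int (2 * n - 2)" using ordn n by (simp add: of_nat_diff)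
  ultimately have "int (2 * n - 2) dvd int (min_distance G G0)" by simp
  then have "2 * n - 2 \<le> min_distance G G0" using A(3) by (intro dvd_imp_le) (simp_all only: of_nat_dvd_iff)
  moreover obtain U where U: "U \<in> atoms G G0" using ex_cross_number_neq_1[OF D] by blast
  then have "davenport G G0 \<le> order G" using size_atom_le_order car by (intro davenport_le[OF U]) auto
  then have "min_distance G G0 + 2 \<le> 2 * n" using min_distance_le_davenport[OF car D] order_2n by simp
  ultimately show ?thesis by simp
qed

lemma min_distance_bound:
  assumes G0: "G0 \<subseteq> carrier G" and D: "Delta G G0 \<noteq> {}" and not_max: "min_distance G G0 \<noteq> 2 * n - 2"
  shows "min_distance G G0 \<le> max 2 (n - 2)"
proof (rule ccontr)
  define d where "d = min_distance G G0"
  assume "\<not> ?thesis"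
  then have d: "d > 2" "n \<le> d + 1" by (auto simp: d_def)
  show False
  \<comment> \<open>Over rotations alone, orders of elements and sizes of atoms are at most
    \<open>n\<close>, so \<open>d <= n - 2\<close>.\<close>
  proof (cases "G0 \<subseteq> rotations")
    case True
    from G0 D show False
    proof (cases rule: min_distance_cases)
      case (large_order g)
      then have "d + 2 \<le> n" using rotation_odd_ord(2)[of g] True by (auto simp: d_def)
      with d show False by simp
    next
      case (large_atom U)
      then have "d + 2 \<le> n"
        using size_atom_le_card[OF _ True rotations_subgroup, of U] card_rotations by (simp add: d_def)
      with d show False by simp
    qed
  next
    case False
    then obtain x where x: "x \<in> G0 - rotations" by blast
    \<comment> \<open>A nontrivial rotation together with the reflection \<open>x\<close> would
      produce lengths differing by 2.\<close>
    have triv: "g = \<one>" if g: "g \<in> G0" "g \<in> rotations" for g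
    proof (rule ccontr)
      assume "g \<noteq> \<one>"
      from rotation_reflection_lengths[OF G0 g this] x
      have "min_distance G G0 \<le> (ord g + 2) - ord g"
        by (intro min_distance_le[OF G0]) auto
      with d show False by (simp add: d_def)
    qed
    \<comment> \<open>The order \<open>m\<close> of the product divides the odd \<open>n\<close>. If
      it were smaller, then \<open>3m <= n <= d + 1 <= 2m - 1\<close>.\<close>
    have ordn: "ord (u \<otimes> v) = n" if uv: "u \<in> G0 - rotations" "v \<in> G0 - rotations" "u \<noteq> v" for u v
    proof (rule ccontr)
      assume neq: "ord (u \<otimes> v) \<noteq> n"
      have R: "u \<in> carrier G - rotations" "v \<in> carrier G - rotations" using uv G0 by auto
      define m where "m = ord (u \<otimes> v)"
      have m: "odd m" "m \<ge> 3" "m \<le> n" using reflection_pair_ord[OF R uv(3)] by (auto simp: m_def)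
      have "u \<otimes> v \<in> carrier G" "u \<otimes> v \<in> rotations" using R reflection_mult by auto
      then obtain k :: int where "u \<otimes> v = a [^] k" using rotations_eq by auto
      then have "(u \<otimes> v) [^] n = \<one>"
        using int_pow_int[of G "a [^] k" n] int_pow_pow[OF a(1), of k "int n"]
          int_pow_eq_id[OF a(1), of "k * int n"] a(2) by simp
      then have "m dvd n" using pow_eq_id \<open>u \<otimes> v \<in> carrier G\<close> by (simp add: m_def)
      then obtain q where q: "n = m * q" by (rule dvdE)
      then have "odd q" "q \<noteq> 1" using n(1) neq by (auto simp: m_def)
      then have "q \<ge> 3" by (cases q rule: parity_cases) (auto elim!: oddE)
      then have "m * 3 \<le> n" unfolding q by (intro mult_le_mono2)
      moreover have "d \<le> 2 * m - 2"
        using reflection_pair_dvd[OF G0 uv] m by (intro dvd_imp_le) (auto simp: d_def m_def)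
      ultimately show False using d m by linarith
    qed
    have two: "\<not> G0 \<subseteq> {\<one>, x, y}" if y: "y \<in> carrier G - rotations" "x \<noteq> y" "ord (x \<otimes> y) = n" for y
      using min_distance_two_reflections[OF _ _ y(1,3,2) D] not_max x G0 by blast
    have "x \<in> carrier G - rotations" using x G0 by blast
    \<comment> \<open>The reflection \<open>x a\<close> need not belong to \<open>G0\<close>. It has
      the product \<open>a\<close> of order \<open>n\<close> with \<open>x\<close>, so
      \<open>two\<close> applies and shows that \<open>G0\<close> has an element besides the
      identity and \<open>x\<close>.\<close>
    have y': "x \<otimes> a \<in> carrier G - rotations" "x \<otimes> (x \<otimes> a) = a"
    proof -
      have xc: "x \<in> carrier G" "x \<notin> rotations" "x \<otimes> x = \<one>"
        using \<open>x \<in> carrier G - rotations\<close> reflection_ord[of x] ord_2_iff[of x] by auto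
      show "x \<otimes> (x \<otimes> a) = a" using xc a by (simp flip: m_assoc)
      have "x \<otimes> a \<notin> rotations"
      proof
        assume xa: "x \<otimes> a \<in> rotations"
        have "a \<in> rotations" unfolding rotations_def by (simp add: generate.incl)
        then have "(x \<otimes> a) \<otimes> inv a \<in> rotations"
          using xa subgroup.m_closed[OF rotations_subgroup] subgroup.m_inv_closed[OF rotations_subgroup] by blast
        moreover have "(x \<otimes> a) \<otimes> inv a = x" using xc a by (simp add: m_assoc)
        ultimately show False using xc by simp
      qed
      then show "x \<otimes> a \<in> carrier G - rotations" using xc a by simp
    qed
    have "x \<noteq> x \<otimes> a"
    proof
      assume "x = x \<otimes> a"
      then have "a = \<one>" using y'(2) \<open>x \<in> carrier G - rotations\<close> reflection_ord[of x] ord_2_iff[of x] by auto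
      then show False using a n by auto
    qed
    then have "\<not> G0 \<subseteq> {\<one>, x, x \<otimes> a}" using two y' a by simp
    then obtain y where y: "y \<in> G0" "y \<noteq> \<one>" "y \<noteq> x" by auto
    then have yR: "y \<in> G0 - rotations" using triv by blast
    then have "\<not> G0 \<subseteq> {\<one>, x, y}" using two[of y] ordn[OF x yR] y G0 by auto
    then obtain z where z: "z \<in> G0" "z \<noteq> \<one>" "z \<noteq> x" "z \<noteq> y" by auto
    then have zR: "z \<in> G0 - rotations" using triv by blast
    have n': "n \<le> min_distance G G0 + 1" using d by (simp add: d_def)
    have 1: "(z \<otimes> x) \<otimes> (z \<otimes> x) = y \<otimes> x"
      using y z by (intro three_reflections[OF G0 x yR zR _ _ _ ordn[OF yR x] n']) auto
    \<comment> \<open>The same relation with \<open>y\<close> and \<open>z\<close> exchanged;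
      together they say \<open>r^4 = r\<close> for \<open>r = y x\<close>.\<close>
    have 2: "(y \<otimes> x) \<otimes> (y \<otimes> x) = z \<otimes> x"
      using y z by (intro three_reflections[OF G0 x zR yR _ _ _ ordn[OF zR x] n']) auto
    define r where "r = y \<otimes> x"
    have r: "r \<in> carrier G" "ord r = n" using ordn[OF yR x] y x G0 by (auto simp: r_def)
    have "(r \<otimes> r) \<otimes> (r \<otimes> r) = r" using 1 2 by (simp add: r_def)
    then have "r \<otimes> (r \<otimes> r \<otimes> r) = r \<otimes> \<one>" using r(1) by (simp add: m_assoc)
    then have "r \<otimes> r \<otimes> r = \<one>" using r(1) by (simp only: l_cancel m_closed one_closed)
    then have "r [^] (3::nat) = \<one>" using r(1) by (simp add: numeral_3_eq_3)
    then have "n dvd 3" using pow_eq_id[OF r(1)] r(2) by blast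
    then have "n = 3" using n by (auto dest: dvd_imp_le)
    \<comment> \<open>Here \<open>4 = 2 * 3 - 2\<close>. As \<open>d > 2\<close>, only the excluded
      value \<open>2n - 2\<close> would remain.\<close>
    then have "d dvd 4" using reflection_pair_dvd[OF G0 yR x] ordn[OF yR x] y by (simp add: d_def)
    then have "d \<le> 4" by (rule dvd_imp_le) simp
    moreover have "d \<noteq> 4" using not_max \<open>n = 3\<close> by (simp add: d_def)
    moreover have "d \<noteq> 3" using \<open>d dvd 4\<close> by auto
    ultimately show False using d by linarith
  qed
qed

lemma Delta_star_bound:
  assumes "d \<in> Delta_star G" "d \<noteq> 2 * n - 2" shows "d \<le> max 2 (n - 2)"
proof -
  obtain G0 where "G0 \<subseteq> carrier G" "Delta G G0 \<noteq> {}" "min_distance G G0 = d"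
    by (rule Delta_starE[OF assms(1)])
  then show ?thesis using min_distance_bound assms(2) by blast
qed

lemma Delta_star_odd_dihedral:
  "{1, 2, n - 2, 2 * n - 2} \<subseteq> Delta_star G" "Max (Delta_star G - {2 * n - 2}) = max 2 (n - 2)"
proof -
  have n2: "n - 2 \<in> Delta_star G" using ord_minus_2_in_Delta_star[OF a(1)] a(2) n by simp
  have "1 \<in> Delta_star G" using one_in_Delta_star order_2n n by simp
  then show "{1, 2, n - 2, 2 * n - 2} \<subseteq> Delta_star G"
    using two_in_Delta_star n2 max_in_Delta_star by blast
  show "Max (Delta_star G - {2 * n - 2}) = max 2 (n - 2)"
  proof (rule Max_eqI)
    show "finite (Delta_star G - {2 * n - 2})" using finite_Delta_star by simp
    show "d \<le> max 2 (n - 2)" if "d \<in> Delta_star G - {2 * n - 2}" for d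
      using Delta_star_bound that by blast
    \<comment> \<open>Whichever of 2 and \<open>n - 2\<close> is larger, it survives the removal of
      \<open>2 * n - 2\<close>. The value 2 wins only for \<open>n = 3\<close>.\<close>
    have "2 \<noteq> 2 * n - 2" "n - 2 \<noteq> 2 * n - 2" using n by auto
    then show "max 2 (n - 2) \<in> Delta_star G - {2 * n - 2}"
      using two_in_Delta_star n2 unfolding max_def by simp
  qed
qed

end

lemma odd_dihedralI:
  fixes G :: "('a, 'b) monoid_scheme"
  assumes "dihedral_group G n" "odd n" "n \<ge> 3" "finite (carrier G)"
  obtains a b where "odd_dihedral G n a b"
proof -
  obtain a b where "group G" "order G = 2 * n" "a \<in> carrier G" "b \<in> carrier G"
    "group.ord G a = n" "group.ord G b = 2" "b \<otimes>\<^bsub>G\<^esub> a \<otimes>\<^bsub>G\<^esub> inv\<^bsub>G\<^esub> b = inv\<^bsub>G\<^esub> a"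
    using assms(1) unfolding dihedral_group_def by blast
  then have "odd_dihedral G n a b"
    using assms(2-4)
    by (intro odd_dihedral.intro finite_group.intro finite_group_axioms.intro odd_dihedral_axioms.intro) auto
  then show thesis by (rule that)
qed

theorem theorem6p8:
  fixes G :: "('a, 'b) monoid_scheme"
  assumes "group G" and "finite (carrier G)" and "order G \<ge> 3"
  shows
    "(1 \<in> Delta_star G \<and>
      {group.ord G g - 2 | g. g \<in> carrier G \<and> group.ord G g \<ge> 3} \<subseteq> Delta_star G) \<and>
     int (Max (Delta_star G)) \<le> int (davenport G (carrier G)) - 2 \<and>
     (Max (Delta_star G) = order G - 2 \<longleftrightarrow>
        cyclic_group G \<or> (\<exists>n. odd n \<and> n \<ge> 3 \<and> dihedral_group G n)) \<and>
     (\<forall>n. odd n \<and> n \<ge> 3 \<and> dihedral_group G n \<longrightarrow>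
        {1, 2, n - 2, 2 * n - 2} \<subseteq> Delta_star G \<and>
        Max (Delta_star G - {2 * n - 2}) = max 2 (n - 2)) \<and>
     (int (Max (Delta_star G)) = int (davenport G (carrier G)) - 2 \<longrightarrow>
        cyclic_group G \<or>
        (\<exists>G1. subgroup G1 G \<and> davenport G G1 = davenport G (carrier G) \<and>
           (\<exists>S \<subseteq> G1. (\<forall>x \<in> S. group.ord G x = 2) \<and> generate G S = G1)))"
proof (intro conjI)
  interpret finite_group G
    using assms by (intro finite_group.intro finite_group_axioms.intro)
  have one: "1 \<in> Delta_star G" by (rule one_in_Delta_star[OF assms(3)])
  \<comment> \<open>The distance 1 makes the set nonempty, which together with finiteness gives
    \<open>Max\<close> its meaning.\<close>
  have Max_in: "Max (Delta_star G) \<in> Delta_star G" using finite_Delta_star one by (intro Max_in) auto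
  \<comment> \<open>Atoms have at most \<open>|G|\<close> terms, so \<open>|G| - 2\<close> is an
    upper bound and membership alone identifies it as the maximum.\<close>
  have Max_eq: "Max (Delta_star G) = order G - 2" if "order G - 2 \<in> Delta_star G"
  proof (rule Max_eqI[OF finite_Delta_star _ that])
    fix d assume "d \<in> Delta_star G"
    then have "d + 2 \<le> order G" using Delta_star_le[of d] davenport_le_order by simp
    then show "d \<le> order G - 2" by simp
  qed
  show "1 \<in> Delta_star G" by (rule one)
  show "{ord g - 2 | g. g \<in> carrier G \<and> ord g \<ge> 3} \<subseteq> Delta_star G"
    using ord_minus_2_in_Delta_star by blast
  show "int (Max (Delta_star G)) \<le> int (davenport G (carrier G)) - 2"
    using Delta_star_le[OF Max_in] by simp
  show dih: "\<forall>n. odd n \<and> n \<ge> 3 \<and> dihedral_group G n \<longrightarrow>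
        {1, 2, n - 2, 2 * n - 2} \<subseteq> Delta_star G \<and> Max (Delta_star G - {2 * n - 2}) = max 2 (n - 2)"
  proof (intro allI impI)
    fix n assume "odd n \<and> n \<ge> 3 \<and> dihedral_group G n"
    then have n: "dihedral_group G n" "odd n" "n \<ge> 3" by auto
    obtain a b where "odd_dihedral G n a b" by (rule odd_dihedralI[OF n assms(2)])
    from odd_dihedral.Delta_star_odd_dihedral[OF this] show "{1, 2, n - 2, 2 * n - 2} \<subseteq> Delta_star G \<and>
        Max (Delta_star G - {2 * n - 2}) = max 2 (n - 2)" by (rule conjI)
  qed
  show "Max (Delta_star G) = order G - 2 \<longleftrightarrow>
        cyclic_group G \<or> (\<exists>n. odd n \<and> n \<ge> 3 \<and> dihedral_group G n)"
  proof
    assume "Max (Delta_star G) = order G - 2"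
    then have "Max (Delta_star G) + 2 = order G" using assms(3) by simp
    then show "cyclic_group G \<or> (\<exists>n. odd n \<and> n \<ge> 3 \<and> dihedral_group G n)"
      by (rule cyclic_or_dihedral_of_max_Delta_star[OF Max_in _ assms(3)])
  next
    assume "cyclic_group G \<or> (\<exists>n. odd n \<and> n \<ge> 3 \<and> dihedral_group G n)"
    then have "order G - 2 \<in> Delta_star G"
    proof
      assume "cyclic_group G"
      then obtain g where g: "g \<in> carrier G" "ord g = order G" by (rule cyclic_groupE)
      then show ?thesis using ord_minus_2_in_Delta_star[OF g(1)] assms(3) by simp
    next
      assume "\<exists>n. odd n \<and> n \<ge> 3 \<and> dihedral_group G n"
      then obtain n where n: "odd n \<and> n \<ge> 3 \<and> dihedral_group G n" ..
      then have "order G = 2 * n" by (simp add: dihedral_group_def)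
      moreover have "2 * n - 2 \<in> Delta_star G" using dih n by blast
      ultimately show ?thesis by simp
    qed
    then show "Max (Delta_star G) = order G - 2" by (rule Max_eq)
  qed
  show "int (Max (Delta_star G)) = int (davenport G (carrier G)) - 2 \<longrightarrow>
        cyclic_group G \<or>
        (\<exists>G1. subgroup G1 G \<and> davenport G G1 = davenport G (carrier G) \<and>
           (\<exists>S \<subseteq> G1. (\<forall>x \<in> S. ord x = 2) \<and> generate G S = G1))"
  proof
    assume "int (Max (Delta_star G)) = int (davenport G (carrier G)) - 2"
    then have "Max (Delta_star G) + 2 = davenport G (carrier G)" by linarith
    then show "cyclic_group G \<or>
        (\<exists>G1. subgroup G1 G \<and> davenport G G1 = davenport G (carrier G) \<and>
           (\<exists>S \<subseteq> G1. (\<forall>x \<in> S. ord x = 2) \<and> generate G S = G1))"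
      using involution_subgroup_of_max_Delta_star[OF Max_in] by blast
  qed
qed

end
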